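(* Let $f:[1,\infty)\to\mathbb{R}$ be non-negative and non-decreasing, and put $F(x)=\sum_{n\le x} f(x/n)$ for $x\ge 1$, the sum running over positive integers $n\le x$. Assume there are real constants $A,B,C$ such that \[ F(x)=Ax\log x+Bx+C\frac{x}{\log x}+o\!\left(\frac{x}{\log x}\right)\quad (x\to\infty). \] Then $f(x)=Ax+o(x)$ as $x\to\infty$. *)

theory Defs
  imports Complex_Main "HOL-Library.Landau_Symbols"
begin

end

theory Submission
  imports Defs
    "HOL-Complex_Analysis.Complex_Analysis"
    "HOL-Computational_Algebra.Primes"
    "HOL-Probability.Sinc_Integral"
    "HOL-Real_Asymp.Real_Asymp"
begin

text \<open>
  This is Ingham's Tauberian theorem; only the remainder \<open>o(x)\<close> in \<open>F\<close> matters. Subtracting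
  \<open>A x + b\<close> from \<open>f\<close> for a suitable constant \<open>b\<close> reduces to the case \<open>F(x) = o(x)\<close>. Put
  \<open>h(v) = e\<^sup>-\<^sup>v f(e\<^sup>v)\<close>, so that \<open>H(v) = e\<^sup>-\<^sup>v F(e\<^sup>v) = \<Sum> h(v - log n) / n\<close> tends to \<open>0\<close>. Let \<open>k\<close> be a function
  whose Fourier transform \<open>\<phi>\<close> is smooth with compact support. Since \<open>\<zeta>(1 + it)\<close> has no zero,
  \<open>\<phi>(t) / \<zeta>(1 + it)\<close> is smooth as well, hence the Fourier transform of an integrable \<open>G\<close>, and
  \<open>h * k = H * G\<close> tends to \<open>0\<close>. Averaging over frequency shifts, the same holds with \<open>k\<close> replaced by the
  positive kernel \<open>|k|\<^sup>2\<close>. As \<open>h\<close> is bounded (by Chebyshev's argument with \<open>F(x) - 2 F(x / 2)\<close>) and can only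
  decrease slowly because \<open>f\<close> is monotone, this forces \<open>h\<close> to tend to \<open>0\<close>.
\<close>

section \<open>The zeta function on the line of real part 1\<close>

text \<open>Since phi has compact support, only the behaviour of zeta on a bounded segment of the
  line matters. The obstacle is the exchange of sum and integral behind h * k = H * G: although H
  tends to 0, the sums of |h(v - log n)| / n are only known to grow at most like 1 + |v|, so
  \<open>G\<close> must decay faster than integrability alone demands. This fixes the cut-off: phi
  is the cube of a quadratic that vanishes at both ends of a segment, the exponent 3 allowing three
  integrations by parts. Between the ends everything extends holomorphically off the line, so
  derivatives cost nothing. The transform of |k|^2, a self-convolution of phi, lacks this form,
  being given by different polynomials on the two halves of its support; shifting the frequencies of
  k keeps the form.\<close>

definition zeta_pole_term :: "nat \<Rightarrow> complex \<Rightarrow> complex" where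
  "zeta_pole_term n s =
     (s - 1) * of_nat (Suc n) powr (-s) + of_nat (Suc (Suc n)) powr (1 - s) - of_nat (Suc n) powr (1 - s)"

text \<open>
  \<open>zeta_pole s\<close> is \<open>(s - 1) \<zeta>(s)\<close>. Comparing \<open>\<Sum> n\<^sup>-\<^sup>s\<close> with \<open>\<integral> x\<^sup>-\<^sup>s dx\<close> on each interval \<open>[n, n + 1]\<close> and
  multiplying by \<open>s - 1\<close> makes every term entire, so nothing has to be divided by \<open>s - 1\<close> at the pole.
\<close>

definition zeta_pole :: "complex \<Rightarrow> complex" where
  "zeta_pole s = 1 + (\<Sum>n. zeta_pole_term n s)"

lemma zeta_pole_partial_sum:
  "1 + (\<Sum>n<N. zeta_pole_term n s) =
     (s - 1) * (\<Sum>n<N. of_nat (Suc n) powr (-s)) + of_nat (Suc N) powr (1 - s)"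
  by (induction N) (auto simp: zeta_pole_term_def algebra_simps)

text \<open>With m = n + 1, the term is the increment over [m, m + 1] of \<open>q\<close>, whose
  derivative (1 - s) (z^(-s) - m^(-s)) vanishes at m. Applying the mean value inequality first to
  z^(-s) and then to \<open>q\<close> gains one power of m, and Re s >= 1/2 makes the exponent -3/2
  summable.\<close>

lemma norm_zeta_pole_term_le:
  assumes "Re s \<ge> 1/2"
  shows "norm (zeta_pole_term n s) \<le> norm (s - 1) * norm s * real (Suc n) powr (-3/2)"
proof -
  define m where "m = real (Suc n)"
  have m: "m \<ge> 1" by (simp add: m_def)
  define T where "T = closed_segment (of_real m) (of_real (m + 1) :: complex)"
  have T: "z \<in> \<real> \<and> m \<le> Re z \<and> Re z \<le> m + 1 \<and> z \<notin> \<real>\<^sub>\<le>\<^sub>0" if "z \<in> T" for z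
  proof -
    from that obtain u where u: "0 \<le> u" "u \<le> 1"
      and z: "z = (1 - u) *\<^sub>R of_real m + u *\<^sub>R (of_real (m + 1) :: complex)"
      by (auto simp: T_def in_segment)
    have "z = of_real (m + u)" by (simp add: z scaleR_conv_of_real algebra_simps)
    thus ?thesis using u m by (auto simp: complex_nonpos_Reals_iff)
  qed
  have mT: "of_real m \<in> T" "of_real (m + 1) \<in> T" by (auto simp: T_def)
  have cv: "convex T" by (simp add: T_def)
  have 1: "norm (z powr (-s) - of_real m powr (-s)) \<le> norm s * m powr (-3/2)" if z: "z \<in> T" for z
  proof -
    have "norm (z powr (-s) - of_real m powr (-s)) \<le> (norm s * m powr (-3/2)) * norm (z - of_real m)"
    proof (rule field_differentiable_bound[OF cv, where f' = "\<lambda>z. -s * z powr (-s - 1)"])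
      fix w assume w: "w \<in> T"
      show "((\<lambda>z. z powr (-s)) has_field_derivative - s * w powr (- s - 1)) (at w within T)"
        using T[OF w] by (auto intro!: derivative_eq_intros)
      have "Re w powr (- Re s - 1) \<le> m powr (- Re s - 1)"
        using T[OF w] m assms by (intro powr_mono2') auto
      also have "\<dots> \<le> m powr (-3/2)"
        using assms m by (intro powr_mono) auto
      finally show "norm (- s * w powr (- s - 1)) \<le> norm s * m powr (-3/2)"
        using T[OF w] m by (auto simp: norm_mult norm_powr_real_powr intro!: mult_left_mono)
    qed (use z mT in auto)
    also have "norm (z - of_real m) \<le> 1"
    proof -
      have "z = of_real (Re z)" using T[OF z] by (auto simp: complex_is_Real_iff complex_eq_iff)
      hence "z - of_real m = of_real (Re z - m)" by (metis of_real_diff)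
      thus ?thesis using T[OF z] by (simp only: norm_of_real) auto
    qed
    finally show ?thesis by (simp add: mult_left_mono)
  qed
  define q where "q = (\<lambda>z. z powr (1 - s) + (s - 1) * of_real m powr (-s) * z)"
  have "norm (q (of_real (m + 1)) - q (of_real m)) \<le>
          (norm (s - 1) * (norm s * m powr (-3/2))) * norm (of_real (m + 1) - of_real m :: complex)"
  proof (rule field_differentiable_bound[OF cv, where f' = "\<lambda>z. (1 - s) * (z powr (-s) - of_real m powr (-s))"])
    fix w assume w: "w \<in> T"
    show "(q has_field_derivative (1 - s) * (w powr - s - of_real m powr - s)) (at w within T)"
    proof -
      have "(q has_field_derivative ((1 - s) * w powr (1 - s - 1) + (s - 1) * of_real m powr (-s))) (at w within T)"
        unfolding q_def using T[OF w] by (auto intro!: derivative_eq_intros)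
      thus ?thesis by (simp add: algebra_simps)
    qed
    show "norm ((1 - s) * (w powr - s - of_real m powr - s)) \<le> norm (s - 1) * (norm s * m powr (-3/2))"
      using 1[OF w] by (simp add: norm_mult norm_minus_commute mult_left_mono)
  qed (use mT in auto)
  also have "q (of_real (m + 1)) - q (of_real m) = zeta_pole_term n s"
    by (simp add: q_def zeta_pole_term_def m_def algebra_simps)
  finally show ?thesis by (simp add: m_def mult.assoc)
qed

lemma uniform_limit_zeta_pole:
  "uniform_limit {s. Re s \<ge> 1/2 \<and> norm s \<le> R} (\<lambda>N s. 1 + (\<Sum>n<N. zeta_pole_term n s)) zeta_pole sequentially"
  unfolding zeta_pole_def
proof (intro uniform_limit_add uniform_limit_const Weierstrass_m_test)
  fix n and s :: complex assume s: "s \<in> {s. Re s \<ge> 1/2 \<and> norm s \<le> R}"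
  have "norm (s - 1) \<le> R + 1" using norm_triangle_ineq4[of s 1] s by auto
  moreover have "norm s \<le> R" using s by auto
  ultimately have "norm (s - 1) * norm s \<le> (R + 1) * R"
    by (intro mult_mono) (auto intro: order_trans[OF norm_ge_zero])
  thus "norm (zeta_pole_term n s) \<le> ((R + 1) * R) * real (Suc n) powr (-3/2)"
    using norm_zeta_pole_term_le[of s n] s by (auto intro: order_trans mult_right_mono)
next
  have "summable (\<lambda>n. real (Suc n) powr (-3/2))"
    by (subst summable_Suc_iff[where f = "\<lambda>n. real n powr (-3/2)"]) (simp add: summable_real_powr_iff)
  thus "summable (\<lambda>n. ((R + 1) * R) * real (Suc n) powr (-3/2))" by (rule summable_mult)
qed

lemma zeta_pole_LIMSEQ:
  assumes "Re s \<ge> 1/2"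
  shows "(\<lambda>N. 1 + (\<Sum>n<N. zeta_pole_term n s)) \<longlonglongrightarrow> zeta_pole s"
  by (rule tendsto_uniform_limitI[OF uniform_limit_zeta_pole[of "norm s"]]) (use assms in auto)

text \<open>The residue of zeta. It settles the one point of the line where the 3-4-1 argument,
  which needs a non-zero imaginary part, does not apply.\<close>

lemma zeta_pole_1 [simp]: "zeta_pole 1 = 1"
proof -
  have "zeta_pole_term n 1 = 0" for n
    by (simp add: zeta_pole_term_def del: of_nat_Suc)
  thus ?thesis by (simp add: zeta_pole_def)
qed

lemma holomorphic_zeta_pole: "zeta_pole holomorphic_on {s. Re s > 1/2}"
proof (rule holomorphic_uniform_sequence)
  show op: "open {s. Re s > 1/2}" by (rule open_halfspace_Re_gt)
  show "(\<lambda>s. 1 + (\<Sum>n<N. zeta_pole_term n s)) holomorphic_on {s. Re s > 1/2}" for N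
    unfolding zeta_pole_term_def by (intro holomorphic_intros)
  fix z assume "z \<in> {s. Re s > 1/2}"
  then obtain d where d: "d > 0" "cball z d \<subseteq> {s. Re s > 1/2}"
    using op open_contains_cball by blast
  have "cball z d \<subseteq> {s. Re s \<ge> 1/2 \<and> norm s \<le> norm z + d}"
  proof
    fix w assume w: "w \<in> cball z d"
    have "norm w \<le> norm z + norm (w - z)" by (rule norm_triangle_sub)
    moreover have "w \<in> {s. Re s > 1/2}" using w d by blast
    ultimately show "w \<in> {s. Re s \<ge> 1/2 \<and> norm s \<le> norm z + d}"
      using w d(1) by (auto simp: dist_norm norm_minus_commute)
  qed
  thus "\<exists>d>0. cball z d \<subseteq> {s. 1 / 2 < Re s} \<and>
      uniform_limit (cball z d) (\<lambda>N s. 1 + (\<Sum>n<N. zeta_pole_term n s)) zeta_pole sequentially"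
    using d uniform_limit_on_subset[OF uniform_limit_zeta_pole] by blast
qed

section \<open>The half-plane of convergence, Euler factors and non-vanishing\<close>

lemma summable_norm_nat_powr:
  assumes "Re s > 1"
  shows "summable (\<lambda>n. norm (of_nat (Suc n) powr (-s) :: complex))"
proof -
  have "summable (\<lambda>n. real (Suc n) powr (- Re s))"
    using assms by (subst summable_Suc_iff[where f = "\<lambda>n. real n powr (- Re s)"]) (simp add: summable_real_powr_iff)
  thus ?thesis by (simp add: norm_powr_real_powr del: of_nat_Suc)
qed

lemma zeta_pole_eq_Dirichlet_series:
  assumes "Re s > 1"
  shows "zeta_pole s = (s - 1) * (\<Sum>n. of_nat (Suc n) powr (-s))"
proof (rule LIMSEQ_unique)
  show "(\<lambda>N. 1 + (\<Sum>n<N. zeta_pole_term n s)) \<longlonglongrightarrow> zeta_pole s"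
    by (rule zeta_pole_LIMSEQ) (use assms in auto)
  have "(\<lambda>N. of_nat (Suc N) powr (1 - s) :: complex) \<longlonglongrightarrow> 0"
  proof (rule tendsto_norm_zero_cancel)
    have "(\<lambda>N. real (Suc N) powr (1 - Re s)) \<longlonglongrightarrow> 0"
      by (rule tendsto_neg_powr)
         (use assms filterlim_real_sequentially in \<open>auto simp: filterlim_sequentially_Suc[where f = real] simp del: of_nat_Suc\<close>)
    thus "(\<lambda>N. norm (of_nat (Suc N) powr (1 - s) :: complex)) \<longlonglongrightarrow> 0"
      by (simp add: norm_powr_real_powr del: of_nat_Suc)
  qed
  moreover have "(\<lambda>N. \<Sum>n<N. of_nat (Suc n) powr (-s) :: complex) \<longlonglongrightarrow> (\<Sum>n. of_nat (Suc n) powr (-s))"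
    by (rule summable_LIMSEQ[OF summable_norm_cancel[OF summable_norm_nat_powr[OF assms]]])
  ultimately have "(\<lambda>N. (s - 1) * (\<Sum>n<N. of_nat (Suc n) powr (-s)) + of_nat (Suc N) powr (1 - s))
      \<longlonglongrightarrow> (s - 1) * (\<Sum>n. of_nat (Suc n) powr (-s)) + 0"
    by (intro tendsto_add tendsto_mult tendsto_const)
  thus "(\<lambda>N. 1 + (\<Sum>n<N. zeta_pole_term n s)) \<longlonglongrightarrow> (s - 1) * (\<Sum>n. of_nat (Suc n) powr (-s))"
    by (simp only: zeta_pole_partial_sum add_0_right)
qed

text \<open>A finite Euler product in sieve form. Among the numbers free of the primes in
  \<open>S\<close>, the multiples of a further prime \<open>p\<close> are exactly p times such
  numbers, so by complete multiplicativity removing them multiplies the sum by 1 - g p.\<close>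

lemma infsum_coprime_to_primes:
  fixes g :: "nat \<Rightarrow> complex"
  assumes mult: "\<And>m n. g (m * n) = g m * g n" and summable: "g summable_on UNIV"
    and "finite S" "\<And>p. p \<in> S \<Longrightarrow> prime p"
  shows "infsum g {n. \<forall>p\<in>S. \<not> p dvd n} = (\<Prod>p\<in>S. 1 - g p) * infsum g UNIV"
  using assms(3,4)
proof (induction S rule: finite_induct)
  case empty
  show ?case by simp
next
  case (insert p S)
  define C where "C = {n. \<forall>q\<in>S. \<not> q dvd n}"
  have p: "prime p" and S: "\<And>q. q \<in> S \<Longrightarrow> prime q" using insert.prems by auto
  have "\<not> q dvd p" if "q \<in> S" for q
    using p S[OF that] that insert.hyps by (metis primes_dvd_imp_eq)
  hence sub: "(*) p ` C \<subseteq> C"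
    using S by (auto simp: C_def prime_dvd_mult_iff)
  have eq: "{n. \<forall>q\<in>insert p S. \<not> q dvd n} = C - (*) p ` C"
  proof -
    have "n \<in> (*) p ` C" if "n \<in> C" "p dvd n" for n
    proof -
      from that obtain k where k: "n = p * k" by (elim dvdE)
      moreover have "k \<in> C" using that by (auto simp: C_def k)
      ultimately show ?thesis by blast
    qed
    thus ?thesis by (auto simp: C_def)
  qed
  have summ: "g summable_on X" for X using summable summable_on_subset_banach by blast
  have "infsum g {n. \<forall>q\<in>insert p S. \<not> q dvd n} = infsum g C - infsum g ((*) p ` C)"
    unfolding eq by (rule infsum_Diff[OF summ summ sub])
  also have "infsum g ((*) p ` C) = infsum (g \<circ> (*) p) C"
    by (rule infsum_reindex) (use p in \<open>auto simp: inj_on_def\<close>)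
  also have "\<dots> = g p * infsum g C"
    by (simp add: o_def mult infsum_cmult_right')
  finally show ?case
    using insert by (simp add: C_def algebra_simps)
qed

text \<open>Apart from 1, and from 0 as long as there is no prime below \<open>N\<close>, a
  surviving number has only prime factors >= \<open>N\<close> and so lies in the tail of an
  absolutely convergent sum.\<close>

lemma infsum_coprime_to_primes_LIMSEQ:
  fixes g :: "nat \<Rightarrow> complex"
  assumes "g 0 = 0" "g 1 = 1" and summable: "(\<lambda>n. norm (g n)) summable_on UNIV"
  shows "(\<lambda>N. infsum g {n. \<forall>p\<in>{p. prime p \<and> p < N}. \<not> p dvd n}) \<longlonglongrightarrow> 1"
proof -
  define C where "C = (\<lambda>N. {n::nat. \<forall>p\<in>{p. prime p \<and> p < N}. \<not> p dvd n})"
  have summ: "(\<lambda>n. norm (g n)) summable_on X" for X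
    using summable summable_on_subset_banach by blast
  hence summ': "g summable_on X" for X
    by (rule abs_summable_summable)
  have bound: "norm (infsum g (C N) - 1) \<le> infsum (\<lambda>n. norm (g n)) UNIV - (\<Sum>n<N. norm (g n))" for N
  proof -
    have sub: "C N - {1} \<subseteq> insert 0 {N..}"
    proof
      fix n assume n: "n \<in> C N - {1}"
      show "n \<in> insert 0 {N..}"
      proof (rule ccontr)
        assume "n \<notin> insert 0 {N..}"
        hence "n \<noteq> 0" "n < N" by auto
        moreover obtain p where "prime p" "p dvd n" using n prime_factor_nat[of n] by auto
        ultimately show False using n dvd_imp_le[of p n] by (auto simp: C_def)
      qed
    qed
    have "1 \<in> C N" by (auto simp: C_def)
    hence "infsum g (C N - {1}) = infsum g (C N) - infsum g {1}"
      by (intro infsum_Diff summ') auto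
    hence "norm (infsum g (C N) - 1) = norm (infsum g (C N - {1}))" using assms by simp
    also have "\<dots> \<le> infsum (\<lambda>n. norm (g n)) (C N - {1})"
      by (rule norm_infsum_bound) (rule summ)
    also have "\<dots> \<le> infsum (\<lambda>n. norm (g n)) {N..}"
      by (rule infsum_mono_neutral[OF summ summ]) (use sub assms in auto)
    also have "{N..} = UNIV - {..<N}" by auto
    also have "infsum (\<lambda>n. norm (g n)) (UNIV - {..<N}) = infsum (\<lambda>n. norm (g n)) UNIV - (\<Sum>n<N. norm (g n))"
      by (subst infsum_Diff[OF summ summ]) auto
    finally show ?thesis .
  qed
  have "(\<lambda>n. norm (g n)) sums infsum (\<lambda>n. norm (g n)) UNIV"
    by (rule has_sum_imp_sums) (use summable in auto)
  hence "(\<lambda>N. infsum (\<lambda>n. norm (g n)) UNIV - (\<Sum>n<N. norm (g n))) \<longlonglongrightarrow> 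
           infsum (\<lambda>n. norm (g n)) UNIV - infsum (\<lambda>n. norm (g n)) UNIV"
    unfolding sums_def by (intro tendsto_intros)
  hence "(\<lambda>N. infsum g (C N) - 1) \<longlonglongrightarrow> 0"
    by (intro Lim_null_comparison[OF always_eventually, rule_format, OF bound]) auto
  thus ?thesis unfolding C_def by (rule LIM_zero_cancel)
qed

text \<open>After taking logarithms, the n-th terms of the three power series combine to -(r^n / n)
  (3 + 4 cos a + cos 2a), where z^n = e^(ia), and the trigonometric sum equals 2 (1 + cos
  a)^2.\<close>

lemma mertens_local_factor_le:
  fixes r :: real and z :: complex
  assumes r: "0 \<le> r" "r < 1" and z: "norm z = 1"
  shows "norm (1 - of_real r :: complex) ^ 3 * norm (1 - of_real r * z) ^ 4 * norm (1 - of_real r * z\<^sup>2) \<le> 1"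
proof -
  \<comment> \<open>The term n = 0 is a division by 0, hence 0, so the series effectively starts at
    1.\<close>
  have sums: "(\<lambda>n. - Re (w ^ n) / real n) sums ln (norm (1 - w))" if "norm w < 1" for w :: complex
  proof -
    have "(\<lambda>n. - (w ^ n) / of_nat n) sums ln (1 + - w)" using Ln_series'[of "-w"] that by simp
    hence "(\<lambda>n. Re (- (w ^ n) / of_nat n)) sums Re (ln (1 + - w))" by (rule sums_Re)
    moreover have "1 - w \<noteq> 0" using that by auto
    ultimately show ?thesis by (simp add: Re_divide_of_nat)
  qed
  have n: "norm (of_real r :: complex) < 1" "norm (of_real r * z) < 1" "norm (of_real r * z\<^sup>2) < 1"
    using assms by (auto simp: norm_mult norm_power)
  have "(\<lambda>n. 3 * (- Re (of_real r ^ n) / real n) + 4 * (- Re ((of_real r * z) ^ n) / real n) +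
           (- Re ((of_real r * z\<^sup>2) ^ n) / real n)) sums
          (3 * ln (norm (1 - of_real r :: complex)) + 4 * ln (norm (1 - of_real r * z)) +
           ln (norm (1 - of_real r * z\<^sup>2)))" (is "?a sums ?L")
    by (intro sums_add sums_mult sums n)
  moreover have "?a n \<le> 0" for n
  proof -
    define u where "u = z ^ n"
    have u: "norm u = 1" by (simp add: u_def norm_power z)
    hence "(Re u)\<^sup>2 + (Im u)\<^sup>2 = 1" by (metis cmod_power2 one_power2)
    hence "3 + 4 * Re u + Re (u\<^sup>2) = 2 * (1 + Re u)\<^sup>2"
      by (simp add: power2_eq_square algebra_simps)
    moreover have "?a n = - (r ^ n / real n) * (3 + 4 * Re u + Re (u\<^sup>2))"
    proof -
      have "of_real r ^ n = (of_real (r ^ n) :: complex)" by simp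
      moreover have "(of_real r * z) ^ n = of_real (r ^ n) * u" by (simp add: u_def power_mult_distrib)
      moreover have "(of_real r * z\<^sup>2) ^ n = of_real (r ^ n) * u\<^sup>2"
        by (simp add: u_def power_mult_distrib flip: power_mult) (simp add: mult.commute)
      moreover have "Re (of_real c * w) = c * Re w" for c w by simp
      ultimately show ?thesis
        by (simp only: Re_complex_of_real) (simp add: algebra_simps add_divide_distrib)
    qed
    ultimately show ?thesis using r by (simp add: mult_nonneg_nonneg)
  qed
  ultimately have L: "?L \<le> 0" using sums_le[of ?a "\<lambda>_. 0"] by auto
  have pos: "norm (1 - of_real r :: complex) > 0" "norm (1 - of_real r * z) > 0" "norm (1 - of_real r * z\<^sup>2) > 0"
    using n by auto
  have "ln (norm (1 - of_real r :: complex) ^ 3 * norm (1 - of_real r * z) ^ 4 * norm (1 - of_real r * z\<^sup>2)) = ?L"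
    using pos by (simp add: ln_mult ln_realpow)
  with L pos show ?thesis by (metis ln_le_zero_iff mult_pos_pos zero_less_power)
qed

lemma powr_nat_mult_complex:
  "(of_nat (m * n) :: complex) powr s = of_nat m powr s * of_nat n powr s"
  using powr_times_real[of "of_nat m" "of_nat n" s] by simp

lemma infsum_nat_powr:
  assumes "Re s > 1"
  shows "(\<lambda>n. norm (of_nat n powr (-s) :: complex)) summable_on UNIV"
    and "infsum (\<lambda>n. of_nat n powr (-s) :: complex) UNIV = (\<Sum>n. of_nat (Suc n) powr (-s))"
proof -
  let ?g = "\<lambda>n. of_nat n powr (-s) :: complex"
  have *: "summable (\<lambda>n. norm (?g n))"
    using summable_norm_nat_powr[OF assms] by (subst (asm) summable_Suc_iff)
  show "(\<lambda>n. norm (?g n)) summable_on UNIV"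
    using * by (intro norm_summable_imp_summable_on) auto
  have "(\<lambda>n. ?g (Suc n)) sums (\<Sum>n. ?g (Suc n))"
    by (rule summable_sums[OF summable_norm_cancel[OF summable_norm_nat_powr[OF assms]]])
  hence "?g sums (\<Sum>n. ?g (Suc n))"
    by (subst (asm) sums_Suc_iff) simp
  thus "infsum ?g UNIV = (\<Sum>n. ?g (Suc n))"
    by (intro infsumI norm_summable_imp_has_sum[OF *])
qed

text \<open>Each \<open>c N s\<close> is \<open>D s\<close> times the factors 1 - p^(-s) for p < N,
  and it tends to 1. By the 3-4-1 inequality at every prime the weighted product of these factors is
  at most 1, so the product of the \<open>c N s\<close> is at most that of the \<open>D s\<close>;
  then \<open>N\<close> tends to infinity.\<close>

lemma mertens_inequality:
  fixes \<sigma> t :: real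
  assumes \<sigma>: "\<sigma> > 1"
  defines "D \<equiv> \<lambda>s::complex. \<Sum>n. of_nat (Suc n) powr (-s)"
  shows "1 \<le> norm (D (of_real \<sigma>)) ^ 3 * norm (D (Complex \<sigma> t)) ^ 4 * norm (D (Complex \<sigma> (2 * t)))"
proof -
  define g where "g = (\<lambda>s n. of_nat n powr (-s) :: complex)"
  define P where "P = (\<lambda>N. {p::nat. prime p \<and> p < N})"
  define c where "c = (\<lambda>N s. infsum (g s) {n. \<forall>p\<in>P N. \<not> p dvd n})"
  have c: "c N s = (\<Prod>p\<in>P N. 1 - g s p) * D s" if "Re s > 1" for N s
    unfolding c_def D_def infsum_nat_powr(2)[OF that, symmetric] g_def
    by (rule infsum_coprime_to_primes)
       (use infsum_nat_powr(1)[OF that] in \<open>auto simp: powr_nat_mult_complex P_def intro: abs_summable_summable simp del: of_nat_mult\<close>)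
  have lim: "(\<lambda>N. c N s) \<longlonglongrightarrow> 1" if "Re s > 1" for s
    unfolding c_def P_def g_def
    by (rule infsum_coprime_to_primes_LIMSEQ) (use infsum_nat_powr(1)[OF that] in auto)
  have "norm (c N (of_real \<sigma>)) ^ 3 * norm (c N (Complex \<sigma> t)) ^ 4 * norm (c N (Complex \<sigma> (2 * t))) \<le>
        norm (D (of_real \<sigma>)) ^ 3 * norm (D (Complex \<sigma> t)) ^ 4 * norm (D (Complex \<sigma> (2 * t)))" for N
  proof -
    have "norm (1 - g (of_real \<sigma>) p) ^ 3 * norm (1 - g (Complex \<sigma> t) p) ^ 4 * norm (1 - g (Complex \<sigma> (2 * t)) p) \<le> 1"
      if p: "p \<in> P N" for p
    proof -
      define r where "r = real p powr (-\<sigma>)"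
      define z where "z = (of_nat p :: complex) powr (- (\<i> * of_real t))"
      have p1: "real p > 1" using p prime_gt_1_nat[of p] by (simp add: P_def)
      have "r < 1" unfolding r_def using p1 \<sigma> by (simp add: powr_less_one)
      moreover have "norm z = 1" using p1 by (simp add: z_def norm_powr_real_powr)
      moreover have "g (of_real \<sigma>) p = of_real r"
        using p1 by (simp add: g_def r_def flip: powr_of_real)
      moreover have "g (Complex \<sigma> t) p = of_real r * z"
      proof -
        have "- Complex \<sigma> t = of_real (-\<sigma>) + - (\<i> * of_real t)" by (simp add: complex_eq_iff)
        thus ?thesis using p1
          by (simp only: g_def powr_add) (simp add: r_def z_def flip: powr_of_real)
      qed
      moreover have "g (Complex \<sigma> (2 * t)) p = of_real r * z\<^sup>2"
      proof -
        have "- Complex \<sigma> (2 * t) = of_real (-\<sigma>) + (- (\<i> * of_real t) + - (\<i> * of_real t))"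
          by (simp add: complex_eq_iff)
        thus ?thesis using p1
          by (simp only: g_def powr_add) (simp add: r_def z_def power2_eq_square flip: powr_of_real)
      qed
      ultimately show ?thesis using mertens_local_factor_le[of r z] by (simp add: r_def)
    qed
    hence "(\<Prod>p\<in>P N. norm (1 - g (of_real \<sigma>) p) ^ 3 * norm (1 - g (Complex \<sigma> t) p) ^ 4 *
             norm (1 - g (Complex \<sigma> (2 * t)) p)) \<le> 1"
      by (intro prod_le_1) auto
    hence "(\<Prod>p\<in>P N. norm (1 - g (of_real \<sigma>) p) ^ 3 * norm (1 - g (Complex \<sigma> t) p) ^ 4 *
             norm (1 - g (Complex \<sigma> (2 * t)) p)) *
           (norm (D (of_real \<sigma>)) ^ 3 * norm (D (Complex \<sigma> t)) ^ 4 * norm (D (Complex \<sigma> (2 * t)))) \<le>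
           norm (D (of_real \<sigma>)) ^ 3 * norm (D (Complex \<sigma> t)) ^ 4 * norm (D (Complex \<sigma> (2 * t)))"
      by (intro mult_left_le_one_le prod_nonneg) auto
    thus ?thesis
      using \<sigma> by (simp add: c norm_mult power_mult_distrib prod.distrib prod_power_distrib mult_ac flip: prod_norm)
  qed
  moreover have "(\<lambda>N. norm (c N (of_real \<sigma>)) ^ 3 * norm (c N (Complex \<sigma> t)) ^ 4 * norm (c N (Complex \<sigma> (2 * t))))
          \<longlonglongrightarrow> norm (1::complex) ^ 3 * norm (1::complex) ^ 4 * norm (1::complex)"
    by (intro tendsto_intros lim) (use \<sigma> in auto)
  ultimately show ?thesis
    using LIMSEQ_le_const2 by (metis (no_types, lifting) norm_one power_one mult_1)
qed

lemma isCont_zeta_pole: "Re s > 1/2 \<Longrightarrow> isCont zeta_pole s"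
  using holomorphic_on_imp_continuous_on[OF holomorphic_zeta_pole]
        continuous_on_eq_continuous_at[OF open_halfspace_Re_gt[of "1/2"]] by blast

text \<open>A zero at 1 + it would make the Mertens product too small: at distance e from the line
  the pole contributes e^(-3), the zero e^4, and the value near 1 + 2it stays bounded, so a product
  that is at least 1 would be O(e).\<close>

theorem zeta_pole_nonzero:
  assumes "Re s = 1"
  shows "zeta_pole s \<noteq> 0"
proof (cases "Im s = 0")
  case True
  hence "s = 1" using assms by (simp add: complex_eq_iff)
  thus ?thesis by simp
next
  case False
  define t where "t = Im s"
  have t: "t \<noteq> 0" and s: "s = Complex 1 t" using False assms by (auto simp: t_def complex_eq_iff)
  show ?thesis
  proof
    assume zero: "zeta_pole s = 0"
    obtain D where D: "(zeta_pole has_field_derivative D) (at s)"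
    proof -
      have "s \<in> {s. Re s > 1/2}" using assms by simp
      thus ?thesis
        using holomorphic_zeta_pole that holomorphic_on_open[OF open_halfspace_Re_gt[of "1/2"]] by blast
    qed
    have shift: "((\<lambda>e. zeta_pole (Complex (1 + e) u)) \<longlongrightarrow> zeta_pole (Complex 1 u)) (at_right 0)" for u
    proof -
      have "((\<lambda>e. Complex (1 + e) u) \<longlongrightarrow> Complex (1 + 0) u) (at_right 0)"
        by (intro tendsto_intros)
      thus ?thesis using isCont_tendsto_compose[OF isCont_zeta_pole, of "Complex 1 u"] by simp
    qed
    have "((\<lambda>h. (zeta_pole (s + h) - zeta_pole s) / h) \<longlongrightarrow> D) (at 0)"
      using D by (simp add: DERIV_def)
    moreover have "filterlim (\<lambda>e::real. of_real e :: complex) (at 0) (at_right 0)"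
      unfolding filterlim_at
      by (intro conjI tendsto_eq_intros eventually_mono[OF eventually_at_right_less]) auto
    ultimately have "((\<lambda>e::real. (zeta_pole (s + of_real e) - zeta_pole s) / of_real e) \<longlongrightarrow> D) (at_right 0)"
      by (rule filterlim_compose)
    hence quot: "((\<lambda>e::real. zeta_pole (Complex (1 + e) t) / of_real e) \<longlongrightarrow> D) (at_right 0)"
    proof -
      have "s + of_real e = Complex (1 + e) t" for e by (simp add: s complex_eq_iff)
      with \<open>(_ \<longlongrightarrow> D) (at_right 0)\<close> zero show ?thesis by simp
    qed
    \<comment> \<open>The Mertens product, with the zero written as a difference quotient; the
      leading factor \<open>e\<close> is what remains of e^4 / e^3.\<close>
    define E where "E = (\<lambda>e. e * (norm (zeta_pole (Complex (1 + e) 0)) ^ 3 *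
        (norm (zeta_pole (Complex (1 + e) t) / of_real e) / norm (Complex e t)) ^ 4 *
        (norm (zeta_pole (Complex (1 + e) (2 * t))) / norm (Complex e (2 * t)))))"
    have "(E \<longlongrightarrow> 0 * (norm (zeta_pole (Complex 1 0)) ^ 3 * (norm D / norm (Complex 0 t)) ^ 4 *
        (norm (zeta_pole (Complex 1 (2 * t))) / norm (Complex 0 (2 * t))))) (at_right 0)"
      unfolding E_def by (intro tendsto_intros shift quot) (use t in \<open>auto simp: complex_eq_iff\<close>)
    moreover have "\<forall>\<^sub>F e in at_right 0. 1 \<le> E e"
      using eventually_at_right_less
    proof eventually_elim
      case (elim e)
      let ?D = "\<lambda>s::complex. \<Sum>n. of_nat (Suc n) powr (-s)"
      have eq: "norm (?D (Complex (1 + e) u)) = norm (zeta_pole (Complex (1 + e) u)) / norm (Complex e u)" for u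
      proof -
        have "Complex (1 + e) u - 1 = Complex e u" by (simp add: complex_eq_iff)
        moreover have "Complex e u \<noteq> 0" using elim by (simp add: complex_eq_iff)
        ultimately show ?thesis
          using zeta_pole_eq_Dirichlet_series[of "Complex (1 + e) u"] elim by (simp add: norm_mult)
      qed
      have "1 \<le> norm (?D (of_real (1 + e))) ^ 3 * norm (?D (Complex (1 + e) t)) ^ 4 * norm (?D (Complex (1 + e) (2 * t)))"
        using mertens_inequality[of "1 + e" t] elim by simp
      also have "of_real (1 + e) = Complex (1 + e) 0" by (simp add: complex_eq_iff)
      also have "norm (?D (Complex (1 + e) 0)) ^ 3 * norm (?D (Complex (1 + e) t)) ^ 4 * norm (?D (Complex (1 + e) (2 * t))) = E e"
      proof -
        have norm_e: "norm (Complex e 0) = e" using elim by (simp add: complex_norm)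
        have "(a / e) ^ 3 * (b / n) ^ 4 * x = e * (a ^ 3 * (b / e / n) ^ 4 * x)" for a b n x :: real
          using elim by (simp add: power_divide eval_nat_numeral mult_ac)
        moreover have "norm (zeta_pole (Complex (1 + e) t) / of_real e) = norm (zeta_pole (Complex (1 + e) t)) / e"
          using elim by (simp add: norm_divide)
        ultimately show ?thesis unfolding eq E_def norm_e by (simp only:)
      qed
      finally show ?case .
    qed
    ultimately have "1 \<le> (0::real)"
      using tendsto_lowerbound[of E 0 "at_right 0" 1] by simp
    thus False by simp
  qed
qed

section \<open>Fourier integrals over segments of the line\<close>

definition line1 :: "real \<Rightarrow> complex" where
  "line1 t = 1 + \<i> * of_real t"

text \<open>The integrand comes from a function of a complex variable so that holomorphy near the
  line supplies all its derivatives and their continuity.\<close>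

definition fourier_segment :: "real \<Rightarrow> real \<Rightarrow> (complex \<Rightarrow> complex) \<Rightarrow> real \<Rightarrow> complex" where
  "fourier_segment a b \<Phi> u = integral {a..b} (\<lambda>t. \<Phi> (line1 t) * exp (\<i> * of_real (t * u)))"

lemma continuous_on_fourier_integrand:
  assumes "\<Phi> holomorphic_on S" "line1 ` {a..b} \<subseteq> S"
  shows "continuous_on {a..b} (\<lambda>t. \<Phi> (line1 t))"
  using assms(2)
  by (intro continuous_on_compose2[OF holomorphic_on_imp_continuous_on[OF assms(1)]])
     (auto simp: line1_def intro!: continuous_intros)

lemma fourier_segment_cong:
  assumes "\<And>t. t \<in> {a..b} \<Longrightarrow> \<Phi> (line1 t) = \<Psi> (line1 t)"
  shows "fourier_segment a b \<Phi> u = fourier_segment a b \<Psi> u"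
  unfolding fourier_segment_def by (intro integral_cong) (use assms in auto)

text \<open>Integration by parts. The i from differentiating along the line cancels the i from the
  exponential.\<close>

lemma fourier_segment_deriv:
  assumes "open S" "\<Phi> holomorphic_on S" "line1 ` {a..b} \<subseteq> S" "a \<le> b"
    and zero: "\<Phi> (line1 a) = 0" "\<Phi> (line1 b) = 0"
  shows "of_real u * fourier_segment a b \<Phi> u = - fourier_segment a b (deriv \<Phi>) u"
proof -
  let ?e = "\<lambda>t. exp (\<i> * of_real (t * u)) :: complex"
  have cont: "continuous_on {a..b} (\<lambda>t. \<Psi> (line1 t) * ?e t)" if "\<Psi> holomorphic_on S" for \<Psi>
    by (intro continuous_intros continuous_on_fourier_integrand[OF that assms(3)])
  have der: "((\<lambda>t. \<Phi> (line1 t) * ?e t) has_vector_derivative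
          (\<i> * (deriv \<Phi> (line1 t) * ?e t) + \<i> * of_real u * (\<Phi> (line1 t) * ?e t))) (at t within {a..b})"
    if "t \<in> {a..b}" for t
  proof -
    have "(\<Phi> has_field_derivative deriv \<Phi> (line1 t)) (at (line1 t))"
      using assms that by (intro holomorphic_derivI[OF assms(2,1)]) auto
    moreover have "((\<lambda>t. line1 t) has_vector_derivative \<i>) (at t within {a..b})"
      unfolding line1_def by (auto intro!: derivative_eq_intros simp: has_vector_derivative_def scaleR_conv_of_real)
    ultimately have 1: "((\<lambda>t. \<Phi> (line1 t)) has_vector_derivative \<i> * deriv \<Phi> (line1 t)) (at t within {a..b})"
      using field_vector_diff_chain_within[of line1 \<i> t "{a..b}" \<Phi> "deriv \<Phi> (line1 t)"]
      by (simp add: o_def has_field_derivative_at_within)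
    have "((\<lambda>t. \<i> * of_real (t * u) :: complex) has_vector_derivative \<i> * of_real u) (at t within {a..b})"
      by (auto intro!: derivative_eq_intros simp: has_vector_derivative_def scaleR_conv_of_real)
    hence 2: "(?e has_vector_derivative \<i> * of_real u * ?e t) (at t within {a..b})"
      using field_vector_diff_chain_within[of "\<lambda>t. \<i> * of_real (t * u)" "\<i> * of_real u" t "{a..b}" exp "exp (\<i> * of_real (t * u))"]
      by (simp add: o_def has_field_derivative_at_within DERIV_exp)
    show ?thesis
      using has_vector_derivative_mult[OF 1 2] by (simp add: algebra_simps)
  qed
  have "((\<lambda>t. \<i> * (deriv \<Phi> (line1 t) * ?e t) + \<i> * of_real u * (\<Phi> (line1 t) * ?e t)) has_integral
          (\<Phi> (line1 b) * ?e b - \<Phi> (line1 a) * ?e a)) {a..b}"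
    by (rule fundamental_theorem_of_calculus[OF \<open>a \<le> b\<close> der])
  hence "integral {a..b} (\<lambda>t. \<i> * (deriv \<Phi> (line1 t) * ?e t) + \<i> * of_real u * (\<Phi> (line1 t) * ?e t)) = 0"
    by (simp add: integral_unique zero)
  also have "integral {a..b} (\<lambda>t. \<i> * (deriv \<Phi> (line1 t) * ?e t) + \<i> * of_real u * (\<Phi> (line1 t) * ?e t)) =
      \<i> * fourier_segment a b (deriv \<Phi>) u + \<i> * of_real u * fourier_segment a b \<Phi> u"
    unfolding fourier_segment_def integral_mult_right[symmetric]
    by (intro integral_add integrable_continuous_real continuous_intros cont assms holomorphic_deriv)
  finally have "\<i> * (of_real u * fourier_segment a b \<Phi> u + fourier_segment a b (deriv \<Phi>) u) = 0"
    by (simp add: algebra_simps)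
  thus ?thesis by (simp add: add_eq_0_iff2)
qed

text \<open>
  A factor \<open>endpoint_poly\<close> to the power \<open>k\<close> kills the boundary terms of \<open>k\<close> integrations by parts.
\<close>

definition endpoint_poly :: "real \<Rightarrow> real \<Rightarrow> complex \<Rightarrow> complex" where
  "endpoint_poly a b s = (s - line1 a) * (s - line1 b)"

lemma holomorphic_endpoint_poly [holomorphic_intros]: "endpoint_poly a b holomorphic_on S"
  unfolding endpoint_poly_def by (intro holomorphic_intros)

lemma fourier_segment_decay:
  assumes "open S" "Q holomorphic_on S" "line1 ` {a..b} \<subseteq> S" "a \<le> b"
  shows "\<exists>M. \<forall>u. \<bar>u\<bar> ^ k * norm (fourier_segment a b (\<lambda>s. endpoint_poly a b s ^ k * Q s) u) \<le> M"
  using assms(2)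
proof (induction k arbitrary: Q)
  case 0
  have cont: "continuous_on {a..b} (\<lambda>t. Q (line1 t))"
    by (rule continuous_on_fourier_integrand[OF 0 assms(3)])
  hence "bounded ((\<lambda>t. Q (line1 t)) ` {a..b})"
    by (intro compact_imp_bounded compact_continuous_image) auto
  then obtain B where B: "\<And>t. t \<in> {a..b} \<Longrightarrow> norm (Q (line1 t)) \<le> B"
    unfolding bounded_iff by blast
  have "norm (fourier_segment a b Q u) \<le> B * (b - a)" for u
    unfolding fourier_segment_def
    by (rule integral_bound[OF \<open>a \<le> b\<close>])
       (auto simp: norm_mult intro!: continuous_intros cont B)
  thus ?case by auto
next
  case (Suc k)
  let ?p = "endpoint_poly a b"
  \<comment> \<open>\<open>?p ^ Suc k * Q\<close> has derivative \<open>?p ^ k * R\<close>, which is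
    of the same shape with one power less; each power of \<open>?p\<close> is traded for a power of
    \<open>u\<close>, and \<open>Q\<close> has to be arbitrary in the induction.\<close>
  define R where "R = (\<lambda>s. of_nat (Suc k) * deriv ?p s * Q s + ?p s * deriv Q s)"
  have "R holomorphic_on S"
    unfolding R_def by (intro holomorphic_intros Suc.prems holomorphic_deriv assms(1))
  then obtain M where M: "\<And>u. \<bar>u\<bar> ^ k * norm (fourier_segment a b (\<lambda>s. ?p s ^ k * R s) u) \<le> M"
    using Suc.IH by blast
  have "\<bar>u\<bar> ^ Suc k * norm (fourier_segment a b (\<lambda>s. ?p s ^ Suc k * Q s) u) \<le> M" for u
  proof -
    have "of_real u * fourier_segment a b (\<lambda>s. ?p s ^ Suc k * Q s) u =
            - fourier_segment a b (deriv (\<lambda>s. ?p s ^ Suc k * Q s)) u"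
      by (rule fourier_segment_deriv[OF assms(1) _ assms(3,4)])
         (auto intro!: holomorphic_intros Suc.prems simp: endpoint_poly_def)
    also have "fourier_segment a b (deriv (\<lambda>s. ?p s ^ Suc k * Q s)) u = fourier_segment a b (\<lambda>s. ?p s ^ k * R s) u"
    proof (rule fourier_segment_cong)
      fix t assume "t \<in> {a..b}"
      hence t: "line1 t \<in> S" using assms(3) by auto
      have p: "(?p has_field_derivative deriv ?p (line1 t)) (at (line1 t))"
        by (rule holomorphic_derivI[OF _ assms(1) t]) (intro holomorphic_intros)
      have q: "(Q has_field_derivative deriv Q (line1 t)) (at (line1 t))"
        by (rule holomorphic_derivI[OF Suc.prems assms(1) t])
      have "((\<lambda>s. ?p s ^ Suc k * Q s) has_field_derivative ?p (line1 t) ^ k * R (line1 t)) (at (line1 t))"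
        using DERIV_mult[OF DERIV_power[OF p, of "Suc k"] q] by (simp add: R_def algebra_simps)
      thus "deriv (\<lambda>s. ?p s ^ Suc k * Q s) (line1 t) = ?p (line1 t) ^ k * R (line1 t)"
        by (rule DERIV_imp_deriv)
    qed
    finally have "\<bar>u\<bar> * norm (fourier_segment a b (\<lambda>s. ?p s ^ Suc k * Q s) u) =
        norm (fourier_segment a b (\<lambda>s. ?p s ^ k * R s) u)"
      by (metis norm_minus_cancel norm_mult norm_of_real)
    thus ?thesis using M[of u] by (simp only: power_Suc2 mult.assoc)
  qed
  thus ?case by blast
qed

text \<open>The weight 1 + |u| is meant to absorb the growth in \<open>sum_shifts_le\<close>, and
  the remaining 1 / (1 + u^2) is integrable. Together they ask for cubic decay, hence the exponent
  3.\<close>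

lemma fourier_segment_bound:
  assumes "open S" "Q holomorphic_on S" "line1 ` {a..b} \<subseteq> S" "a \<le> b"
  obtains M where "M \<ge> 0"
    "\<And>u. (1 + \<bar>u\<bar>) * norm (fourier_segment a b (\<lambda>s. endpoint_poly a b s ^ 3 * Q s) u) \<le> M / (1 + u\<^sup>2)"
proof -
  let ?G = "fourier_segment a b (\<lambda>s. endpoint_poly a b s ^ 3 * Q s)"
  obtain M0 where M0: "\<And>u. norm (?G u) \<le> M0"
  proof -
    have "(\<lambda>s. endpoint_poly a b s ^ 3 * Q s) holomorphic_on S" by (intro holomorphic_intros assms)
    from fourier_segment_decay[OF assms(1) this assms(3,4), of 0] that show ?thesis by auto
  qed
  obtain M3 where M3: "\<And>u. \<bar>u\<bar> ^ 3 * norm (?G u) \<le> M3"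
    using fourier_segment_decay[OF assms, of 3] by auto
  have "M0 \<ge> 0" using M0[of 0] norm_ge_zero order_trans by blast
  moreover have "M3 \<ge> 0" using M3[of 0] by simp
  moreover have "(1 + \<bar>u\<bar>) * norm (?G u) \<le> (3 * (M0 + M3)) / (1 + u\<^sup>2)" for u
  proof -
    define x where "x = \<bar>u\<bar>"
    have x: "x \<ge> 0" "x\<^sup>2 = u\<^sup>2" by (auto simp: x_def)
    have "x \<le> 1 + x ^ 3" "x\<^sup>2 \<le> 1 + x ^ 3"
    proof -
      have "x \<le> 1 + x ^ 3 \<and> x\<^sup>2 \<le> 1 + x ^ 3"
      proof (cases "x \<le> 1")
        case True
        thus ?thesis using x power_le_one[of x 2] by (auto intro: order_trans)
      next
        case False
        hence "x ^ 1 \<le> x ^ 3" "x ^ 2 \<le> x ^ 3" by (intro power_increasing; simp)+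
        thus ?thesis by auto
      qed
      thus "x \<le> 1 + x ^ 3" "x\<^sup>2 \<le> 1 + x ^ 3" by auto
    qed
    hence "(1 + x) * (1 + x\<^sup>2) \<le> 3 * (1 + x ^ 3)"
      by (simp add: algebra_simps power2_eq_square power3_eq_cube)
    hence "(1 + x) * (1 + x\<^sup>2) * norm (?G u) \<le> 3 * (1 + x ^ 3) * norm (?G u)"
      by (rule mult_right_mono) auto
    also have "\<dots> = 3 * (norm (?G u) + x ^ 3 * norm (?G u))" by (simp add: algebra_simps)
    also have "\<dots> \<le> 3 * (M0 + M3)" using M0[of u] M3[of u] by (simp add: x_def)
    finally have "(1 + \<bar>u\<bar>) * norm (?G u) * (1 + u\<^sup>2) \<le> 3 * (M0 + M3)"
      using x by (simp add: x_def mult_ac)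
    moreover have "1 + u\<^sup>2 > 0" by (simp add: add_pos_nonneg)
    ultimately show ?thesis by (simp add: pos_le_divide_eq)
  qed
  ultimately show ?thesis using that[of "3 * (M0 + M3)"] by simp
qed

lemma continuous_on_fourier_segment:
  assumes "\<Phi> holomorphic_on S" "line1 ` {a..b} \<subseteq> S"
  shows "continuous_on UNIV (fourier_segment a b \<Phi>)"
proof -
  have "continuous_on (UNIV \<times> {a..b}) (\<lambda>(u, t). \<Phi> (line1 t) * exp (\<i> * of_real (t * u)))"
    unfolding case_prod_beta
    by (intro continuous_intros continuous_on_compose2[OF continuous_on_fourier_integrand[OF assms]]) auto
  thus ?thesis
    unfolding fourier_segment_def
    using integral_continuous_on_param[of UNIV a b "\<lambda>u t. \<Phi> (line1 t) * exp (\<i> * of_real (t * u))"] by simp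
qed

section \<open>The kernel, its quotient by zeta and the identity linking them\<close>

definition smooth_kernel :: "real \<Rightarrow> real \<Rightarrow> real \<Rightarrow> complex" where
  "smooth_kernel a b = fourier_segment a b (\<lambda>s. endpoint_poly a b s ^ 3)"

text \<open>The factor \<open>(s - 1) / zeta_pole s\<close> is 1 / zeta(s) in a form that is regular
  at s = 1, with value 0 there.\<close>

definition zeta_kernel :: "real \<Rightarrow> real \<Rightarrow> real \<Rightarrow> complex" where
  "zeta_kernel a b = fourier_segment a b (\<lambda>s. endpoint_poly a b s ^ 3 * ((s - 1) / zeta_pole s))"

text \<open>An open neighbourhood of the whole line: openness upgrades non-vanishing on the line to
  holomorphy of the quotient, as the integrations by parts require.\<close>

definition zeta_domain :: "complex set" where
  "zeta_domain = {s. Re s > 1/2} \<inter> zeta_pole -` (- {0})"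

lemma open_zeta_domain: "open zeta_domain"
  unfolding zeta_domain_def
  using holomorphic_on_imp_continuous_on[OF holomorphic_zeta_pole]
  by (intro continuous_open_preimage open_halfspace_Re_gt) auto

lemma line1_in_zeta_domain: "line1 ` X \<subseteq> zeta_domain"
  by (auto simp: zeta_domain_def line1_def zeta_pole_nonzero)

lemma holomorphic_inverse_zeta_pole: "(\<lambda>s. 1 / zeta_pole s) holomorphic_on zeta_domain"
proof -
  have "zeta_pole holomorphic_on zeta_domain"
    by (rule holomorphic_on_subset[OF holomorphic_zeta_pole]) (auto simp: zeta_domain_def)
  thus ?thesis by (intro holomorphic_intros) (auto simp: zeta_domain_def)
qed

lemma smooth_kernel_bound:
  assumes "a \<le> b"
  obtains M where "M \<ge> 0" "\<And>u. (1 + \<bar>u\<bar>) * norm (smooth_kernel a b u) \<le> M / (1 + u\<^sup>2)"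
proof -
  have "(\<lambda>_. 1::complex) holomorphic_on UNIV" by (rule holomorphic_on_const)
  from fourier_segment_bound[OF open_UNIV this _ assms] that show ?thesis
    by (simp add: smooth_kernel_def) blast
qed

lemma zeta_kernel_bound:
  assumes "a \<le> b"
  obtains M where "M \<ge> 0" "\<And>u. (1 + \<bar>u\<bar>) * norm (zeta_kernel a b u) \<le> M / (1 + u\<^sup>2)"
proof -
  have "(\<lambda>s. (s - 1) * (1 / zeta_pole s)) holomorphic_on zeta_domain"
    by (intro holomorphic_intros holomorphic_inverse_zeta_pole)
  hence "(\<lambda>s. (s - 1) / zeta_pole s) holomorphic_on zeta_domain" by simp
  from fourier_segment_bound[OF open_zeta_domain this line1_in_zeta_domain assms] that show ?thesis
    unfolding zeta_kernel_def by blast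
qed

lemma continuous_on_smooth_kernel: "continuous_on UNIV (smooth_kernel a b)"
  unfolding smooth_kernel_def
  by (rule continuous_on_fourier_segment[where S = UNIV]) (auto intro!: holomorphic_intros)

lemma continuous_on_zeta_kernel: "continuous_on UNIV (zeta_kernel a b)"
proof -
  have "(\<lambda>s. endpoint_poly a b s ^ 3 * ((s - 1) * (1 / zeta_pole s))) holomorphic_on zeta_domain"
    by (intro holomorphic_intros holomorphic_inverse_zeta_pole)
  thus ?thesis unfolding zeta_kernel_def
    by (intro continuous_on_fourier_segment[OF _ line1_in_zeta_domain]) simp
qed

lemma continuous_on_zeta_integrand:
  "continuous_on {a..b} (\<lambda>t. endpoint_poly a b (line1 t) ^ 3 * (1 / zeta_pole (line1 t)))"
  by (rule continuous_on_fourier_integrand[OF _ line1_in_zeta_domain, of "\<lambda>s. endpoint_poly a b s ^ 3 * (1 / zeta_pole s)"])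
     (intro holomorphic_intros holomorphic_inverse_zeta_pole)

lemma continuous_on_zeta_pole_partial_sum:
  "continuous_on {a..b} (\<lambda>t. 1 + (\<Sum>n<N. zeta_pole_term n (line1 t)))"
proof (rule continuous_on_fourier_integrand[where S = UNIV and \<Phi> = "\<lambda>s. 1 + (\<Sum>n<N. zeta_pole_term n s)"])
  show "(\<lambda>s. 1 + (\<Sum>n<N. zeta_pole_term n s)) holomorphic_on UNIV"
    unfolding zeta_pole_term_def by (intro holomorphic_intros)
qed auto

lemma nat_powr_line1:
  "of_nat (Suc n) powr (- line1 t) = exp (- \<i> * of_real (t * ln (real (Suc n)))) / of_nat (Suc n)"
  "of_nat (Suc n) powr (1 - line1 t) = exp (- \<i> * of_real (t * ln (real (Suc n))))"
proof -
  have Ln: "Ln (of_nat (Suc n)) = of_real (ln (real (Suc n)))"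
    by (metis Ln_of_nat of_nat_0_less_iff zero_less_Suc)
  show eq: "of_nat (Suc n) powr (1 - line1 t) = exp (- \<i> * of_real (t * ln (real (Suc n))))"
    by (simp add: powr_def Ln line1_def mult_ac del: of_nat_Suc)
  have "of_nat (Suc n) powr (1 - line1 t) = of_nat (Suc n) powr (- line1 t) * of_nat (Suc n)"
    using powr_add[of "of_nat (Suc n) :: complex" "- line1 t" 1] by (simp del: of_nat_Suc)
  thus "of_nat (Suc n) powr (- line1 t) = exp (- \<i> * of_real (t * ln (real (Suc n)))) / of_nat (Suc n)"
    unfolding eq by (simp del: of_nat_Suc)
qed

text \<open>On the line n^(-s) is 1/n times a phase that translates the Fourier variable by log n.
  The left side is therefore \<open>zeta_pole_partial_sum\<close> under the integral; its boundary
  term is a pure phase and becomes the last integral, evaluated at w - log (N + 1).\<close>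

lemma zeta_kernel_partial_sum:
  "(\<Sum>n<N. zeta_kernel a b (w - ln (real (Suc n))) / of_nat (Suc n)) =
     fourier_segment a b (\<lambda>s. endpoint_poly a b s ^ 3 * (1 / zeta_pole s) * (1 + (\<Sum>n<N. zeta_pole_term n s))) w -
     fourier_segment a b (\<lambda>s. endpoint_poly a b s ^ 3 * (1 / zeta_pole s)) (w - ln (real (Suc N)))"
proof -
  let ?Q = "\<lambda>t. endpoint_poly a b (line1 t) ^ 3 * (1 / zeta_pole (line1 t))"
  let ?e = "\<lambda>t u. exp (\<i> * of_real (t * u)) :: complex"
  let ?T = "\<lambda>t. 1 + (\<Sum>n<N. zeta_pole_term n (line1 t))"
  note Q = continuous_on_zeta_integrand[of a b]
  note T = continuous_on_zeta_pole_partial_sum[of a b]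
  have l: "continuous_on {a..b} line1" unfolding line1_def by (intro continuous_intros)
  have shift: "?e t (w - ln (real (Suc n))) = ?e t w * exp (- \<i> * of_real (t * ln (real (Suc n))))" for t n
    by (simp add: exp_add[symmetric] algebra_simps del: of_nat_Suc)
  have "(\<Sum>n<N. zeta_kernel a b (w - ln (real (Suc n))) / of_nat (Suc n)) =
        integral {a..b} (\<lambda>t. \<Sum>n<N. ?Q t * (line1 t - 1) * ?e t (w - ln (real (Suc n))) / of_nat (Suc n))"
  proof (subst integral_sum)
    show "(\<lambda>t. ?Q t * (line1 t - 1) * ?e t (w - ln (real (Suc n))) / of_nat (Suc n)) integrable_on {a..b}" for n
      by (intro integrable_continuous_real continuous_intros Q l) (auto simp del: of_nat_Suc)
  next
    show "(\<Sum>n<N. zeta_kernel a b (w - ln (real (Suc n))) / of_nat (Suc n)) =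
      (\<Sum>n<N. integral {a..b} (\<lambda>t. ?Q t * (line1 t - 1) * ?e t (w - ln (real (Suc n))) / of_nat (Suc n)))"
      unfolding zeta_kernel_def fourier_segment_def integral_divide
      by (intro sum.cong refl arg_cong2[where f = "(/)"] integral_cong) (simp add: mult_ac)
  qed auto
  also have "\<dots> = integral {a..b} (\<lambda>t. ?Q t * ?T t * ?e t w - ?Q t * ?e t (w - ln (real (Suc N))))"
  proof (rule integral_cong)
    fix t assume "t \<in> {a..b}"
    have "(\<Sum>n<N. ?Q t * (line1 t - 1) * ?e t (w - ln (real (Suc n))) / of_nat (Suc n)) =
          ?Q t * ?e t w * ((line1 t - 1) * (\<Sum>n<N. of_nat (Suc n) powr (- line1 t)))"
      unfolding sum_distrib_left nat_powr_line1 shift by (intro sum.cong) (auto simp: mult_ac simp del: of_nat_Suc)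
    also have "(line1 t - 1) * (\<Sum>n<N. of_nat (Suc n) powr (- line1 t)) = ?T t - exp (- \<i> * of_real (t * ln (real (Suc N))))"
      using zeta_pole_partial_sum[where N = N and s = "line1 t"] unfolding nat_powr_line1(2) by (simp del: of_nat_Suc)
    finally show "(\<Sum>n<N. ?Q t * (line1 t - 1) * ?e t (w - ln (real (Suc n))) / of_nat (Suc n)) =
        ?Q t * ?T t * ?e t w - ?Q t * ?e t (w - ln (real (Suc N)))"
      unfolding shift by (simp add: algebra_simps del: of_nat_Suc)
  qed
  also have "\<dots> = integral {a..b} (\<lambda>t. ?Q t * ?T t * ?e t w) - integral {a..b} (\<lambda>t. ?Q t * ?e t (w - ln (real (Suc N))))"
    by (rule integral_diff; intro integrable_continuous_real continuous_intros Q T)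
  finally show ?thesis by (simp add: fourier_segment_def)
qed

text \<open>
  Convolving \<open>zeta_kernel\<close> with the measure \<open>\<Sum> \<delta>(log n) / n\<close> multiplies its Fourier transform by \<open>\<zeta>(1 + it)\<close>
  and returns \<open>smooth_kernel\<close>. The partial sums of \<open>\<Sum> n\<^bsup>-1-it\<^esup>\<close> diverge, but their oscillating part
  contributes a Fourier integral evaluated at \<open>w - log N\<close>, which tends to \<open>0\<close>.
\<close>

lemma zeta_kernel_sums:
  assumes "a \<le> b"
  shows "(\<lambda>n. zeta_kernel a b (w - ln (real (Suc n))) / of_nat (Suc n)) sums smooth_kernel a b w"
proof -
  let ?Q = "\<lambda>t. endpoint_poly a b (line1 t) ^ 3 * (1 / zeta_pole (line1 t))"
  let ?T = "\<lambda>N t. 1 + (\<Sum>n<N. zeta_pole_term n (line1 t))"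
  let ?e = "\<lambda>t. exp (\<i> * of_real (t * w)) :: complex"
  note Q = continuous_on_zeta_integrand[of a b]
  note T = continuous_on_zeta_pole_partial_sum[of a b]
  have "bounded (line1 ` {a..b})"
    by (intro compact_imp_bounded compact_continuous_image) (auto simp: line1_def intro!: continuous_intros)
  then obtain R where R: "\<And>t. t \<in> {a..b} \<Longrightarrow> norm (line1 t) \<le> R" unfolding bounded_iff by blast
  have uT: "uniform_limit {a..b} ?T (\<lambda>t. zeta_pole (line1 t)) sequentially"
    by (rule uniform_limit_compose'[OF uniform_limit_zeta_pole[of R]]) (use R in \<open>auto simp: line1_def\<close>)
  have Z: "continuous_on {a..b} (\<lambda>t. zeta_pole (line1 t))"
    by (rule continuous_on_fourier_integrand[OF holomorphic_zeta_pole]) (auto simp: line1_def)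
  have bdd: "bounded (f ` {a..b})" if "continuous_on {a..b} f" for f :: "real \<Rightarrow> complex"
    using that by (intro compact_imp_bounded compact_continuous_image) auto
  have "uniform_limit {a..b} (\<lambda>N t. (?Q t * ?e t) * ?T N t) (\<lambda>t. (?Q t * ?e t) * zeta_pole (line1 t)) sequentially"
  proof (rule uniform_lim_mult[OF uniform_limit_const uT])
    show "bounded ((\<lambda>t. ?Q t * ?e t) ` {a..b})" by (intro bdd continuous_intros Q)
    show "bounded ((\<lambda>t. zeta_pole (line1 t)) ` {a..b})" by (intro bdd Z)
  qed
  then obtain I J where I: "\<And>N. ((\<lambda>t. (?Q t * ?e t) * ?T N t) has_integral I N) {a..b}"
    and J: "((\<lambda>t. (?Q t * ?e t) * zeta_pole (line1 t)) has_integral J) {a..b}" and lim: "I \<longlonglongrightarrow> J"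
  proof (rule uniform_limit_integral)
    show "continuous_on {a..b} (\<lambda>t. (?Q t * ?e t) * ?T N t)" for N by (intro continuous_intros Q T)
  qed auto
  have "I = (\<lambda>N. fourier_segment a b (\<lambda>s. endpoint_poly a b s ^ 3 * (1 / zeta_pole s) * (1 + (\<Sum>n<N. zeta_pole_term n s))) w)"
    using integral_unique[OF I] by (intro ext) (simp add: fourier_segment_def mult_ac)
  moreover have "J = smooth_kernel a b w"
  proof -
    have "zeta_pole (line1 t) \<noteq> 0" for t by (simp add: zeta_pole_nonzero line1_def)
    thus ?thesis using integral_unique[OF J] by (simp add: smooth_kernel_def fourier_segment_def mult_ac)
  qed
  ultimately have lim1: "(\<lambda>N. fourier_segment a b (\<lambda>s. endpoint_poly a b s ^ 3 * (1 / zeta_pole s) * (1 + (\<Sum>n<N. zeta_pole_term n s))) w)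
      \<longlonglongrightarrow> smooth_kernel a b w" using lim by (simp only:)
  have lim2: "(\<lambda>N. fourier_segment a b (\<lambda>s. endpoint_poly a b s ^ 3 * (1 / zeta_pole s)) (w - ln (real (Suc N)))) \<longlonglongrightarrow> 0"
  proof -
    obtain M where M: "M \<ge> 0" "\<And>u. (1 + \<bar>u\<bar>) * norm (fourier_segment a b (\<lambda>s. endpoint_poly a b s ^ 3 * (1 / zeta_pole s)) u) \<le> M / (1 + u\<^sup>2)"
      using fourier_segment_bound[OF open_zeta_domain holomorphic_inverse_zeta_pole line1_in_zeta_domain assms] by blast
    have "norm (fourier_segment a b (\<lambda>s. endpoint_poly a b s ^ 3 * (1 / zeta_pole s)) u) \<le> M / (1 + u\<^sup>2)" for u
      by (rule order_trans[OF _ M(2)[of u]]) (simp add: algebra_simps)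
    hence "\<forall>\<^sub>F N in sequentially. norm (fourier_segment a b (\<lambda>s. endpoint_poly a b s ^ 3 * (1 / zeta_pole s))
        (w - ln (real (Suc N)))) \<le> M / (1 + (w - ln (real (Suc N)))\<^sup>2)"
      by (intro always_eventually allI)
    moreover have "(\<lambda>N. M / (1 + (w - ln (real (Suc N)))\<^sup>2)) \<longlonglongrightarrow> 0" by real_asymp
    ultimately show ?thesis by (rule Lim_null_comparison)
  qed
  show ?thesis
    unfolding sums_def zeta_kernel_partial_sum using tendsto_diff[OF lim1 lim2] by (simp only: diff_zero)
qed

section \<open>Convolutions\<close>

lemma integrable_inverse_1_plus_square_lborel: "integrable lborel (\<lambda>u::real. M / (1 + u\<^sup>2))"
  using integrable_inverse_1_plus_square
  by (auto simp: set_integrable_def divide_inverse)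

lemma integrable_kernel:
  fixes G :: "real \<Rightarrow> complex"
  assumes "continuous_on UNIV G" "\<And>u. (1 + \<bar>u\<bar>) * norm (G u) \<le> M / (1 + u\<^sup>2)"
  shows "integrable lborel G" "integrable lborel (\<lambda>u. (1 + \<bar>u\<bar>) * norm (G u))"
proof -
  have [measurable]: "G \<in> borel_measurable borel"
    by (rule borel_measurable_continuous_onI[OF assms(1)])
  show "integrable lborel G"
  proof (rule Bochner_Integration.integrable_bound[OF integrable_inverse_1_plus_square_lborel[of M]])
    have "norm (G u) \<le> M / (1 + u\<^sup>2)" for u
      by (rule order_trans[OF _ assms(2)[of u]]) (simp add: algebra_simps)
    thus "AE u in lborel. norm (G u) \<le> norm (M / (1 + u\<^sup>2))"
      by (intro always_eventually allI) (smt (verit) norm_ge_zero real_norm_def)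
  qed simp
  show "integrable lborel (\<lambda>u. (1 + \<bar>u\<bar>) * norm (G u))"
  proof (rule Bochner_Integration.integrable_bound[OF integrable_inverse_1_plus_square_lborel[of M]])
    show "AE u in lborel. norm ((1 + \<bar>u\<bar>) * norm (G u)) \<le> norm (M / (1 + u\<^sup>2))"
      by (intro always_eventually allI) (smt (verit) assms(2) mult_nonneg_nonneg norm_ge_zero real_norm_def)
  qed simp
qed

lemma harm_le_1_plus_ln: "m > 0 \<Longrightarrow> harm m \<le> 1 + ln (real m)"
  using euler_mascheroni_sequence_decreasing[of 1 m] by (simp add: harm_expand)

text \<open>Only the integers up to e^v contribute, because \<open>h\<close> vanishes on the
  negative axis, so the sum is at most \<open>M\<close> times a harmonic number.\<close>

lemma sum_shifts_le:
  fixes h :: "real \<Rightarrow> real"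
  assumes h: "\<And>v. \<bar>h v\<bar> \<le> M" and h0: "\<And>v. v < 0 \<Longrightarrow> h v = 0"
  shows "(\<Sum>n<N. \<bar>h (v - ln (real (Suc n)))\<bar> / real (Suc n)) \<le> M * (1 + \<bar>v\<bar>)"
proof -
  have M: "M \<ge> 0" using h[of 0] by linarith
  have zero: "h (v - ln (real (Suc n))) = 0" if "real (Suc n) > exp v" for n
  proof -
    have "ln (real (Suc n)) > v" using that by (metis exp_gt_zero ln_exp ln_less_cancel_iff of_nat_0_less_iff zero_less_Suc)
    thus ?thesis by (intro h0) linarith
  qed
  define m where "m = nat \<lfloor>exp v\<rfloor>"
  have m: "real n \<le> exp v \<longleftrightarrow> n \<le> m" for n
    by (simp add: m_def le_nat_iff le_floor_iff)
  show ?thesis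
  proof (cases "m = 0")
    case True
    have "(\<Sum>n<N. \<bar>h (v - ln (real (Suc n)))\<bar> / real (Suc n)) = 0"
      using zero m True by (intro sum.neutral) (metis abs_zero div_0 le_zero_eq nat.distinct(1) not_le)
    thus ?thesis using M by simp
  next
    case False
    have "(\<Sum>n<N. \<bar>h (v - ln (real (Suc n)))\<bar> / real (Suc n)) \<le> (\<Sum>n<m. M / real (Suc n))"
    proof -
      have "\<bar>h (v - ln (real (Suc n)))\<bar> / real (Suc n) \<le> (if n \<in> {..<m} then M / real (Suc n) else 0)" for n
      proof (cases "Suc n \<le> m")
        case True
        thus ?thesis using h by (auto intro!: divide_right_mono)
      next
        case False
        thus ?thesis using zero[of n] m[of "Suc n"] by auto
      qed
      hence "(\<Sum>n<N. \<bar>h (v - ln (real (Suc n)))\<bar> / real (Suc n)) \<le> (\<Sum>n<N. if n \<in> {..<m} then M / real (Suc n) else 0)"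
        by (intro sum_mono)
      also have "\<dots> = (\<Sum>n\<in>{..<N} \<inter> {..<m}. M / real (Suc n))"
        by (rule sum.inter_restrict[symmetric]) simp
      also have "\<dots> \<le> (\<Sum>n<m. M / real (Suc n))"
        using M by (intro sum_mono2) auto
      finally show ?thesis .
    qed
    also have "\<dots> = M * harm m"
      by (simp add: harm_def sum_distrib_left divide_inverse sum.atLeast1_atMost_eq)
    also have "\<dots> \<le> M * (1 + \<bar>v\<bar>)"
    proof -
      have "real m \<le> exp v" using m by simp
      hence "ln (real m) \<le> v" using False by (metis bot_nat_0.not_eq_extremum ln_exp ln_mono of_nat_0_less_iff exp_gt_zero)
      thus ?thesis using harm_le_1_plus_ln[of m] False M by (intro mult_left_mono) auto
    qed
    finally show ?thesis .
  qed
qed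

text \<open>\<open>zeta_kernel_sums\<close> writes the kernel as a sum of translates of
  \<open>G\<close>; moving the translations over to \<open>h\<close> produces \<open>H\<close>. The
  exchange of sum and integral plays the linear growth in \<open>sum_shifts_le\<close> against the
  weighted integrability of \<open>G\<close>.\<close>

lemma smooth_convolution_tendsto_0:
  fixes h :: "real \<Rightarrow> real"
  assumes [measurable]: "h \<in> borel_measurable borel"
    and h: "\<And>v. \<bar>h v\<bar> \<le> M" and h0: "\<And>v. v < 0 \<Longrightarrow> h v = 0"
    and lim: "((\<lambda>v. \<Sum>n. h (v - ln (real (Suc n))) / real (Suc n)) \<longlongrightarrow> 0) at_top"
    and "a \<le> b"
  shows "((\<lambda>y. \<integral>w. h (y - w) *\<^sub>R smooth_kernel a b w \<partial>lborel) \<longlongrightarrow> 0) at_top"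
proof -
  define G where "G = zeta_kernel a b"
  define H where "H = (\<lambda>v. \<Sum>n. h (v - ln (real (Suc n))) / real (Suc n))"
  have M: "M \<ge> 0" using h[of 0] by linarith
  have cont: "continuous_on UNIV G" unfolding G_def by (rule continuous_on_zeta_kernel)
  obtain M' where M': "\<And>u. (1 + \<bar>u\<bar>) * norm (G u) \<le> M' / (1 + u\<^sup>2)"
    unfolding G_def using zeta_kernel_bound[OF \<open>a \<le> b\<close>] by blast
  note G_int = integrable_kernel[OF cont M']
  have [measurable]: "G \<in> borel_measurable borel"
    by (rule borel_measurable_continuous_onI[OF cont])
  have summable_h: "summable (\<lambda>n. \<bar>h (v - ln (real (Suc n)))\<bar> / real (Suc n))" for v
    by (rule summableI_nonneg_bounded[OF _ sum_shifts_le[OF h h0]]) auto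
  have H_le: "\<bar>H v\<bar> \<le> M * (1 + \<bar>v\<bar>)" for v
  proof -
    have "\<bar>H v\<bar> \<le> (\<Sum>n. \<bar>h (v - ln (real (Suc n))) / real (Suc n)\<bar>)"
      unfolding H_def by (rule summable_rabs) (use summable_h[of v] in \<open>simp add: abs_divide\<close>)
    also have "\<dots> \<le> M * (1 + \<bar>v\<bar>)"
      by (rule suminf_le_const) (use summable_h[of v] sum_shifts_le[OF h h0, where v = v] in \<open>auto simp: abs_divide\<close>)
    finally show ?thesis .
  qed
  have swap: "(\<integral>w. h (y - w) *\<^sub>R smooth_kernel a b w \<partial>lborel) = (\<integral>u. H (y - u) *\<^sub>R G u \<partial>lborel)" for y
  proof -
    \<comment> \<open>\<open>f n\<close> and \<open>g n\<close> agree up to a translation by log (n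
      + 1), so their integrals are equal; summing the first over \<open>n\<close> rebuilds the
      kernel, summing the second rebuilds \<open>H\<close>.\<close>
    define f where "f = (\<lambda>n w. (h (y - w) / real (Suc n)) *\<^sub>R G (w - ln (real (Suc n))))"
    define g where "g = (\<lambda>n u. (h (y - u - ln (real (Suc n))) / real (Suc n)) *\<^sub>R G u)"
    have gf: "g n u = f n (ln (real (Suc n)) + 1 * u)" for n u
      by (simp add: f_def g_def algebra_simps)
    have g_int: "integrable lborel (g n)" for n
    proof (rule Bochner_Integration.integrable_bound[OF integrable_scaleR_right[OF G_int(1), of M]])
      show "AE u in lborel. norm (g n u) \<le> norm (M *\<^sub>R G u)"
      proof (intro always_eventually allI)
        fix u
        have "\<bar>h (y - u - ln (real (Suc n)))\<bar> / real (Suc n) \<le> M / 1"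
          by (intro frac_le M h) auto
        from mult_right_mono[OF this norm_ge_zero[of "G u"]] show "norm (g n u) \<le> norm (M *\<^sub>R G u)"
          using M by (simp add: g_def abs_divide)
      qed
    qed (simp add: g_def)
    have f_int: "integrable lborel (f n)" for n
      using g_int[of n] unfolding gf by (subst (asm) lborel_integrable_real_affine_iff) auto
    have eq: "integral\<^sup>L lborel (f n) = integral\<^sup>L lborel (g n)" for n
      using lborel_integral_real_affine[of 1 "f n" "ln (real (Suc n))"] unfolding gf by simp
    have eq': "(\<integral>w. norm (f n w) \<partial>lborel) = (\<integral>u. norm (g n u) \<partial>lborel)" for n
      using lborel_integral_real_affine[of 1 "\<lambda>w. norm (f n w)" "ln (real (Suc n))"] unfolding gf by simp
    \<comment> \<open>The bound is uniform in \<open>N\<close>; the inequality 1 + |y - u| <= (1 +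
      |y|) (1 + |u|) separates the fixed \<open>y\<close> from the integrable weight.\<close>
    have "(\<Sum>n<N. \<integral>u. norm (g n u) \<partial>lborel) \<le> (\<integral>u. M * (1 + \<bar>y\<bar>) * ((1 + \<bar>u\<bar>) * norm (G u)) \<partial>lborel)" for N
    proof -
      have "(\<Sum>n<N. \<integral>u. norm (g n u) \<partial>lborel) = (\<integral>u. (\<Sum>n<N. norm (g n u)) \<partial>lborel)"
        by (rule Bochner_Integration.integral_sum[symmetric]) (intro integrable_norm g_int)
      also have "\<dots> \<le> (\<integral>u. M * (1 + \<bar>y\<bar>) * ((1 + \<bar>u\<bar>) * norm (G u)) \<partial>lborel)"
      proof (rule integral_mono)
        fix u
        have "(\<Sum>n<N. norm (g n u)) = (\<Sum>n<N. \<bar>h (y - u - ln (real (Suc n)))\<bar> / real (Suc n)) * norm (G u)"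
          by (simp add: g_def sum_distrib_right abs_divide)
        also have "\<dots> \<le> (M * (1 + \<bar>y - u\<bar>)) * norm (G u)"
          by (intro mult_right_mono sum_shifts_le h h0) auto
        also have "\<dots> \<le> (M * ((1 + \<bar>y\<bar>) * (1 + \<bar>u\<bar>))) * norm (G u)"
        proof -
          have "\<bar>y - u\<bar> \<le> \<bar>y\<bar> + \<bar>u\<bar> + \<bar>y\<bar> * \<bar>u\<bar>"
            using abs_triangle_ineq4[of y u] by (smt (verit) mult_nonneg_nonneg)
          hence "1 + \<bar>y - u\<bar> \<le> (1 + \<bar>y\<bar>) * (1 + \<bar>u\<bar>)" by (simp add: algebra_simps)
          thus ?thesis using M by (intro mult_right_mono mult_left_mono) auto
        qed
        finally show "(\<Sum>n<N. norm (g n u)) \<le> M * (1 + \<bar>y\<bar>) * ((1 + \<bar>u\<bar>) * norm (G u))"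
          by (simp add: mult_ac)
      qed (intro Bochner_Integration.integrable_sum integrable_norm g_int integrable_mult_right G_int)+
      finally show ?thesis .
    qed
    hence summ: "summable (\<lambda>n. \<integral>u. norm (g n u) \<partial>lborel)"
      by (intro summableI_nonneg_bounded) auto
    have "(\<lambda>n. integral\<^sup>L lborel (g n)) sums (\<integral>u. (\<Sum>n. g n u) \<partial>lborel)"
    proof (rule sums_integral[OF g_int _ summ])
      have "summable (\<lambda>n. norm (g n u))" for u
        using summable_mult2[OF summable_h[of "y - u"], of "norm (G u)"] by (simp add: g_def abs_divide)
      thus "AE u in lborel. summable (\<lambda>n. norm (g n u))" by simp
    qed
    moreover have "(\<Sum>n. g n u) = H (y - u) *\<^sub>R G u" for u
    proof -
      have "summable (\<lambda>n. h (y - u - ln (real (Suc n))) / real (Suc n))"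
        by (rule summable_rabs_cancel) (use summable_h[of "y - u"] in \<open>simp add: abs_divide\<close>)
      thus ?thesis unfolding g_def H_def by (rule suminf_scaleR_left[symmetric])
    qed
    \<comment> \<open>The norms of \<open>f n\<close> and \<open>g n\<close> have the same
      integrals, so the sum of the norms of the \<open>f n\<close> has finite integral; this gives
      absolute convergence at almost every \<open>w\<close>, which suffices.\<close>
    moreover have "(\<lambda>n. integral\<^sup>L lborel (f n)) sums (\<integral>w. (\<Sum>n. f n w) \<partial>lborel)"
    proof (rule sums_integral[OF f_int])
      show "summable (\<lambda>n. \<integral>w. norm (f n w) \<partial>lborel)" unfolding eq' by (rule summ)
      have [measurable]: "f n \<in> borel_measurable lborel" for n
        using f_int by (rule borel_measurable_integrable)
      have "(\<integral>\<^sup>+w. (\<Sum>n. ennreal (norm (f n w))) \<partial>lborel) = (\<Sum>n. \<integral>\<^sup>+w. ennreal (norm (f n w)) \<partial>lborel)"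
        by (rule nn_integral_suminf) simp
      also have "\<dots> = (\<Sum>n. ennreal (\<integral>w. norm (f n w) \<partial>lborel))"
        by (intro suminf_cong nn_integral_eq_integral integrable_norm f_int) auto
      finally have "(\<integral>\<^sup>+w. (\<Sum>n. ennreal (norm (f n w))) \<partial>lborel) = (\<Sum>n. ennreal (\<integral>w. norm (f n w) \<partial>lborel))" .
      moreover have "(\<Sum>n. ennreal (\<integral>w. norm (f n w) \<partial>lborel)) \<noteq> \<infinity>"
        unfolding eq' infinity_ennreal_def by (rule ennreal_suminf_neq_top[OF summ]) simp
      ultimately have "AE w in lborel. (\<Sum>n. ennreal (norm (f n w))) \<noteq> \<infinity>"
        by (intro nn_integral_PInf_AE) auto
      thus "AE w in lborel. summable (\<lambda>n. norm (f n w))"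
        by eventually_elim (auto intro: summable_suminf_not_top)
    qed
    moreover have "(\<Sum>n. f n w) = h (y - w) *\<^sub>R smooth_kernel a b w" for w
    proof -
      have "(\<lambda>n. h (y - w) *\<^sub>R (G (w - ln (real (Suc n))) / of_nat (Suc n))) sums (h (y - w) *\<^sub>R smooth_kernel a b w)"
        unfolding G_def by (intro sums_scaleR_right zeta_kernel_sums \<open>a \<le> b\<close>)
      moreover have "f n w = h (y - w) *\<^sub>R (G (w - ln (real (Suc n))) / of_nat (Suc n))" for n
        by (simp add: f_def scaleR_conv_of_real)
      ultimately show ?thesis by (simp add: sums_iff)
    qed
    ultimately show ?thesis using sums_unique2 by (simp only: eq) blast
  qed
  obtain V where V: "\<And>v. v \<ge> V \<Longrightarrow> \<bar>H v\<bar> \<le> 1"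
  proof -
    have "\<forall>\<^sub>F v in at_top. \<bar>H v\<bar> < 1"
      using tendstoD[OF lim, of 1] by (simp add: H_def)
    thus ?thesis using that by (auto simp: eventually_at_top_linorder intro: less_imp_le)
  qed
  \<comment> \<open>\<open>H\<close> vanishes for v < 0, is bounded by 1 beyond \<open>V\<close>,
    and obeys the linear bound in between.\<close>
  define B where "B = M * (1 + \<bar>V\<bar>) + 1"
  have B: "\<bar>H v\<bar> \<le> B" for v
  proof -
    consider "v < 0" | "0 \<le> v" "v \<le> V" | "v \<ge> V" by linarith
    thus ?thesis
    proof cases
      case 1
      have "h (v - ln (real (Suc n))) = 0" for n
        using 1 by (intro h0) (smt (verit) ln_ge_zero of_nat_Suc of_nat_0_le_iff)
      hence "H v = 0" by (simp add: H_def)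
      thus ?thesis using M by (simp add: B_def)
    next
      case 2
      hence "M * (1 + \<bar>v\<bar>) \<le> M * (1 + \<bar>V\<bar>)" using M by (intro mult_left_mono) auto
      thus ?thesis using H_le[of v] by (simp add: B_def)
    next
      case 3
      have "M * (1 + \<bar>V\<bar>) \<ge> 0" using M by simp
      thus ?thesis using V[OF 3] by (simp add: B_def)
    qed
  qed
  have [measurable]: "H \<in> borel_measurable borel" unfolding H_def by measurable
  have "((\<lambda>y. \<integral>u. H (y - u) *\<^sub>R G u \<partial>lborel) \<longlongrightarrow> (\<integral>u. 0 \<partial>(lborel :: real measure))) at_top"
  proof (rule integral_dominated_convergence_at_top[where w = "\<lambda>u. B * norm (G u)"])
    show "integrable lborel (\<lambda>u. B * norm (G u))"
      by (intro integrable_mult_right integrable_norm G_int)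
    show "\<forall>\<^sub>F y in at_top. AE u in lborel. norm (H (y - u) *\<^sub>R G u) \<le> B * norm (G u)"
      using B by (intro always_eventually allI) (auto intro!: mult_right_mono)
    show "AE u in lborel. ((\<lambda>y. H (y - u) *\<^sub>R G u) \<longlongrightarrow> 0) at_top"
    proof (intro always_eventually allI)
      fix u
      have "filterlim (\<lambda>y::real. y - u) at_top at_top" by real_asymp
      from filterlim_compose[OF lim this] have "((\<lambda>y. H (y - u)) \<longlongrightarrow> 0) at_top" by (simp add: H_def)
      from tendsto_scaleR[OF this tendsto_const[of "G u"]] show "((\<lambda>y. H (y - u) *\<^sub>R G u) \<longlongrightarrow> 0) at_top" by simp
    qed
  qed measurable
  thus ?thesis by (simp add: swap)
qed

section \<open>From modulated kernels to a nonnegative kernel\<close>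

lemma smooth_kernel_modulate:
  "smooth_kernel (a + s) (b + s) w = exp (\<i> * of_real (s * w)) * smooth_kernel a b w"
proof -
  have poly: "endpoint_poly (a + s) (b + s) (line1 (s + t)) = endpoint_poly a b (line1 t)" for t
    by (simp add: endpoint_poly_def line1_def algebra_simps)
  have "smooth_kernel (a + s) (b + s) w =
      integral {a..b} ((\<lambda>t. endpoint_poly (a + s) (b + s) (line1 t) ^ 3 * exp (\<i> * of_real (t * w))) \<circ> (+) s)"
    unfolding smooth_kernel_def fourier_segment_def by (rule integral_shift_Icc_real[symmetric])
  also have "\<dots> = integral {a..b} (\<lambda>t. exp (\<i> * of_real (s * w)) * (endpoint_poly a b (line1 t) ^ 3 * exp (\<i> * of_real (t * w))))"
    by (intro integral_cong) (simp add: o_def poly ring_distribs exp_add)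
  also have "\<dots> = exp (\<i> * of_real (s * w)) * smooth_kernel a b w"
    unfolding smooth_kernel_def fourier_segment_def by (rule integral_mult_right)
  finally show ?thesis .
qed

lemma endpoint_poly_symmetric: "endpoint_poly (-L) L (line1 t) = of_real (L\<^sup>2 - t\<^sup>2)"
  by (simp add: endpoint_poly_def line1_def complex_eq_iff power2_eq_square algebra_simps)

text \<open>Write |k|^2 as conjugate times k and expand only the conjugate as a Fourier integral
  over \<open>s\<close>. The phase e^(-isw) times k is the kernel of the segment shifted by -s,
  which is why \<open>smooth_kernel\<close> has two arbitrary endpoints.\<close>

lemma norm_smooth_kernel_squared:
  "of_real ((norm (smooth_kernel (-L) L w))\<^sup>2) =
     (\<integral>s. indicator {-L..L} s *\<^sub>R (of_real ((L\<^sup>2 - s\<^sup>2) ^ 3) * smooth_kernel (-L - s) (L - s) w) \<partial>lborel)"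
proof -
  let ?k = "smooth_kernel (-L) L w"
  let ?f = "\<lambda>s. of_real ((L\<^sup>2 - s\<^sup>2) ^ 3) * exp (\<i> * of_real (s * w)) :: complex"
  have mod: "smooth_kernel (-L - s) (L - s) w = cnj (exp (\<i> * of_real (s * w))) * ?k" for s
    using smooth_kernel_modulate[of "-L" "-s" L w] by (simp add: exp_cnj)
  have f: "set_integrable lborel {-L..L} ?f"
    by (intro borel_integrable_atLeastAtMost' continuous_intros)
  have "(\<integral>s. indicator {-L..L} s *\<^sub>R (of_real ((L\<^sup>2 - s\<^sup>2) ^ 3) * smooth_kernel (-L - s) (L - s) w) \<partial>lborel) =
        (\<integral>s. cnj (indicator {-L..L} s *\<^sub>R ?f s) * ?k \<partial>lborel)"
    unfolding mod by (intro Bochner_Integration.integral_cong) (auto simp: indicator_def)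
  also have "\<dots> = cnj (\<integral>s. indicator {-L..L} s *\<^sub>R ?f s \<partial>lborel) * ?k"
    using f by (subst integral_bounded_linear[OF bounded_linear_cnj, symmetric])
      (simp_all only: integral_mult_left_zero set_integrable_def)
  also have "(\<integral>s. indicator {-L..L} s *\<^sub>R ?f s \<partial>lborel) = integral {-L..L} ?f"
    using set_borel_integral_eq_integral(2)[OF f] by (simp add: set_lebesgue_integral_def)
  also have "\<dots> = ?k"
    unfolding smooth_kernel_def fourier_segment_def endpoint_poly_symmetric by simp
  finally show ?thesis
    by (simp only: complex_norm_square mult.commute)
qed

lemma integrable_smooth_kernel:
  assumes "a \<le> b"
  shows "integrable lborel (smooth_kernel a b)"
  using smooth_kernel_bound[OF assms] integrable_kernel(1)[OF continuous_on_smooth_kernel] by metis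

text \<open>
  A nonnegative kernel is needed for the Tauberian step. The square of the absolute value of a
  \<open>smooth_kernel\<close> is an average of modulated, i.e. frequency-shifted, copies of the kernel itself.
\<close>

lemma fejer_convolution_tendsto_0:
  fixes h :: "real \<Rightarrow> real"
  assumes h_meas [measurable]: "h \<in> borel_measurable borel"
    and h: "\<And>v. \<bar>h v\<bar> \<le> M" and h0: "\<And>v. v < 0 \<Longrightarrow> h v = 0"
    and lim: "((\<lambda>v. \<Sum>n. h (v - ln (real (Suc n))) / real (Suc n)) \<longlongrightarrow> 0) at_top"
    and L: "L \<ge> 0"
  shows "((\<lambda>y. \<integral>w. h (y - w) * (norm (smooth_kernel (-L) L w))\<^sup>2 \<partial>lborel) \<longlongrightarrow> 0) at_top"
proof -
  define k where "k = smooth_kernel (-L) L"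
  define \<phi> where "\<phi> = (\<lambda>s::real. indicator {-L..L} s * (L\<^sup>2 - s\<^sup>2) ^ 3 :: real)"
  define J where "J = (\<lambda>y s. \<integral>w. h (y - w) *\<^sub>R smooth_kernel (-L - s) (L - s) w \<partial>lborel)"
  have M: "M \<ge> 0" using h[of 0] by linarith
  have k_int: "integrable lborel k" unfolding k_def using L by (intro integrable_smooth_kernel) auto
  have [measurable]: "k \<in> borel_measurable borel"
    unfolding k_def by (rule borel_measurable_continuous_onI[OF continuous_on_smooth_kernel])
  have \<phi>_int: "integrable lborel \<phi>"
  proof -
    have "set_integrable lborel {-L..L} (\<lambda>s. (L\<^sup>2 - s\<^sup>2) ^ 3)"
      by (intro borel_integrable_atLeastAtMost' continuous_intros)
    thus ?thesis by (simp add: set_integrable_def \<phi>_def)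
  qed
  have [measurable]: "\<phi> \<in> borel_measurable borel" using \<phi>_int by auto
  have mod: "smooth_kernel (-L - s) (L - s) w = exp (- \<i> * of_real (s * w)) * k w" for s w
    using smooth_kernel_modulate[of "-L" "-s" L w] by (simp add: k_def)
  have hk_int: "integrable lborel (\<lambda>w. h (y - w) *\<^sub>R k w)" for y
  proof (rule Bochner_Integration.integrable_bound[OF integrable_scaleR_right[OF k_int, of M]])
    show "AE w in lborel. norm (h (y - w) *\<^sub>R k w) \<le> norm (M *\<^sub>R k w)"
      using M h by (intro always_eventually allI) (auto intro!: mult_right_mono)
  qed simp
  have swap: "of_real (\<integral>w. h (y - w) * (norm (k w))\<^sup>2 \<partial>lborel) = (\<integral>s. \<phi> s *\<^sub>R J y s \<partial>lborel)" for y
  proof -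
    \<comment> \<open>Integrating over \<open>s\<close> first gives |k|^2, over \<open>w\<close>
      first the average of the convolutions \<open>J\<close>.\<close>
    define \<Psi> where "\<Psi> = (\<lambda>w s. \<phi> s *\<^sub>R (exp (- \<i> * of_real (s * w)) * (h (y - w) *\<^sub>R k w)))"
    have norm_\<Psi>: "norm (\<Psi> w s) = norm (h (y - w) *\<^sub>R k w) * norm (\<phi> s)" for w s
      by (simp add: \<Psi>_def norm_mult abs_mult)
    have \<Psi>_meas [measurable]: "case_prod \<Psi> \<in> borel_measurable (lborel \<Otimes>\<^sub>M lborel)"
      unfolding \<Psi>_def by measurable
    have "integrable (lborel \<Otimes>\<^sub>M lborel) (case_prod \<Psi>)"
    proof (rule lborel_pair.Fubini_integrable[OF \<Psi>_meas])
      show "integrable lborel (\<lambda>w. \<integral>s. norm (case_prod \<Psi> (w, s)) \<partial>lborel)"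
        unfolding prod.case norm_\<Psi> by (simp only: integral_mult_right_zero) (intro integrable_mult_left integrable_norm hk_int)
      show "AE w in lborel. integrable lborel (\<lambda>s. case_prod \<Psi> (w, s))"
      proof (intro always_eventually allI)
        fix w
        have "integrable lborel (\<lambda>s. norm (h (y - w) *\<^sub>R k w) * norm (\<phi> s))"
          by (intro integrable_mult_right integrable_norm \<phi>_int)
        thus "integrable lborel (\<lambda>s. case_prod \<Psi> (w, s))"
        proof (rule Bochner_Integration.integrable_bound)
          show "(\<lambda>s. case_prod \<Psi> (w, s)) \<in> borel_measurable lborel" by (simp add: \<Psi>_def)
          show "AE s in lborel. norm (case_prod \<Psi> (w, s)) \<le> norm (norm (h (y - w) *\<^sub>R k w) * norm (\<phi> s))"
            unfolding prod.case norm_\<Psi> by simp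
        qed
      qed
    qed
    hence "(\<integral>s. (\<integral>w. \<Psi> w s \<partial>lborel) \<partial>lborel) = (\<integral>w. (\<integral>s. \<Psi> w s \<partial>lborel) \<partial>lborel)"
      by (rule lborel_pair.Fubini_integral)
    moreover have "(\<integral>w. \<Psi> w s \<partial>lborel) = \<phi> s *\<^sub>R J y s" for s
      unfolding \<Psi>_def J_def mod integral_scaleR_right[symmetric] by (simp only: mult_scaleR_right)
    moreover have "(\<integral>s. \<Psi> w s \<partial>lborel) = of_real (h (y - w) * (norm (k w))\<^sup>2)" for w
    proof -
      have "\<Psi> w s = of_real (h (y - w)) * (indicator {-L..L} s *\<^sub>R (of_real ((L\<^sup>2 - s\<^sup>2) ^ 3) * smooth_kernel (-L - s) (L - s) w))" for s
        by (simp add: \<Psi>_def mod \<phi>_def scaleR_conv_of_real mult_ac)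
      hence "(\<integral>s. \<Psi> w s \<partial>lborel) = of_real (h (y - w)) * of_real ((norm (k w))\<^sup>2)"
        unfolding k_def norm_smooth_kernel_squared by (simp only: integral_mult_right_zero)
      thus ?thesis by simp
    qed
    ultimately show ?thesis by (simp only: integral_complex_of_real)
  qed
  have "((\<lambda>y. \<integral>s. \<phi> s *\<^sub>R J y s \<partial>lborel) \<longlongrightarrow> (\<integral>s. 0 \<partial>(lborel :: real measure))) at_top"
  proof (rule integral_dominated_convergence_at_top[where w = "\<lambda>s. norm (\<phi> s) * (M * (\<integral>w. norm (k w) \<partial>lborel))"])
    show "integrable lborel (\<lambda>s. norm (\<phi> s) * (M * (\<integral>w. norm (k w) \<partial>lborel)))"
      by (intro integrable_mult_left integrable_norm \<phi>_int)
    \<comment> \<open>The phase has modulus 1, so a single bound covers every shift \<open>s\<close>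
      and every \<open>y\<close>.\<close>
    have "norm (J y s) \<le> M * (\<integral>w. norm (k w) \<partial>lborel)" for y s
    proof -
      have "norm (J y s) \<le> (\<integral>w. M * norm (k w) \<partial>lborel)"
        unfolding J_def mod
      proof (rule Bochner_Integration.integral_norm_bound_integral)
        show le: "norm (h (y - w) *\<^sub>R (exp (- \<i> * of_real (s * w)) * k w)) \<le> M * norm (k w)" for w
          using h[of "y - w"] by (simp add: norm_mult mult_right_mono)
        show int: "integrable lborel (\<lambda>w. M * norm (k w))"
          by (intro integrable_mult_right integrable_norm k_int)
        show "integrable lborel (\<lambda>w. h (y - w) *\<^sub>R (exp (- \<i> * of_real (s * w)) * k w))"
          by (rule Bochner_Integration.integrable_bound[OF int])
             (use le M in \<open>auto simp: abs_mult\<close>)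
      qed
      thus ?thesis by simp
    qed
    thus "\<forall>\<^sub>F y in at_top. AE s in lborel. norm (\<phi> s *\<^sub>R J y s) \<le> norm (\<phi> s) * (M * (\<integral>w. norm (k w) \<partial>lborel))"
      by (intro always_eventually allI) (auto intro!: mult_left_mono)
    have "((\<lambda>y. J y s) \<longlongrightarrow> 0) at_top" for s
      unfolding J_def using L by (intro smooth_convolution_tendsto_0[OF h_meas h h0 lim]) auto
    thus "AE s in lborel. ((\<lambda>y. \<phi> s *\<^sub>R J y s) \<longlongrightarrow> 0) at_top"
      using tendsto_scaleR[OF tendsto_const] by (intro always_eventually allI) fastforce
    show "(\<lambda>s. \<phi> s *\<^sub>R J y s) \<in> borel_measurable lborel" for y
      unfolding J_def mod by measurable
  qed measurable
  hence "((\<lambda>y. of_real (\<integral>w. h (y - w) * (norm (k w))\<^sup>2 \<partial>lborel) :: complex) \<longlongrightarrow> of_real 0) at_top"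
    by (simp add: swap)
  thus ?thesis unfolding tendsto_of_real_iff k_def .
qed

section \<open>The Tauberian argument\<close>

definition fejer_kernel :: "real \<Rightarrow> real" where
  "fejer_kernel w = (norm (smooth_kernel (-1) 1 w))\<^sup>2"

text \<open>Six powers of \<open>L\<close> come from (L^2 - t^2)^3 and one from dt. Widening the
  segment thus concentrates one fixed profile near 0.\<close>

lemma smooth_kernel_scale:
  assumes "L > 0"
  shows "smooth_kernel (-L) L w = of_real (L ^ 7) * smooth_kernel (-1) 1 (L * w)"
proof -
  let ?f = "\<lambda>t. of_real (L\<^sup>2 - t\<^sup>2) ^ 3 * exp (\<i> * of_real (t * w)) :: complex"
  have "(\<lambda>x. x / L) ` {-L..L} = {-1..1}"
    using assms by (simp add: image_divide_atLeastAtMost)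
  hence "integral {-1..1} (\<lambda>x. ?f (L * x)) = (1 / L) *\<^sub>R integral {-L..L} ?f"
    using integral_stretch_real[of L "-L" L ?f] assms by simp
  also have "(\<lambda>x. ?f (L * x)) = (\<lambda>x. of_real (L ^ 6) * (of_real (1\<^sup>2 - x\<^sup>2) ^ 3 * exp (\<i> * of_real (x * (L * w)))))"
  proof
    fix x
    have "L\<^sup>2 - (L * x)\<^sup>2 = L\<^sup>2 * (1\<^sup>2 - x\<^sup>2)" by (simp add: power_mult_distrib algebra_simps)
    hence "of_real (L\<^sup>2 - (L * x)\<^sup>2) ^ 3 = (of_real (L ^ 6) * of_real (1\<^sup>2 - x\<^sup>2) ^ 3 :: complex)"
      by (simp add: power_mult_distrib del: of_real_diff flip: power_mult)
    thus "?f (L * x) = of_real (L ^ 6) * (of_real (1\<^sup>2 - x\<^sup>2) ^ 3 * exp (\<i> * of_real (x * (L * w))))"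
      by (simp add: mult_ac)
  qed
  finally have "of_real (L ^ 6) * smooth_kernel (-1) 1 (L * w) = (1 / L) *\<^sub>R smooth_kernel (-L) L w"
    unfolding smooth_kernel_def fourier_segment_def endpoint_poly_symmetric by simp
  hence "smooth_kernel (-L) L w = L *\<^sub>R (of_real (L ^ 6) * smooth_kernel (-1) 1 (L * w))"
    using assms by simp
  thus ?thesis by (simp add: scaleR_conv_of_real power_numeral_reduce mult_ac)
qed

lemma continuous_on_fejer_kernel: "continuous_on UNIV fejer_kernel"
  unfolding fejer_kernel_def by (intro continuous_intros continuous_on_smooth_kernel)

lemma integrable_fejer_kernel: "integrable lborel fejer_kernel"
proof -
  obtain M where M: "M \<ge> 0" "\<And>u. (1 + \<bar>u\<bar>) * norm (smooth_kernel (-1) 1 u) \<le> M / (1 + u\<^sup>2)"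
    using smooth_kernel_bound[of "-1" 1] by auto
  have le: "norm (smooth_kernel (-1) 1 u) \<le> M / (1 + u\<^sup>2)" for u
    by (rule order_trans[OF _ M(2)[of u]]) (simp add: algebra_simps)
  have "M / (1 + u\<^sup>2) \<le> M / 1" for u using M(1) by (intro divide_left_mono) (auto simp: add_pos_nonneg)
  hence le': "norm (smooth_kernel (-1) 1 u) \<le> M" for u using le[of u] by (metis div_by_1 order_trans)
  show ?thesis
  proof (rule Bochner_Integration.integrable_bound)
    show "integrable lborel (\<lambda>u. M * norm (smooth_kernel (-1) 1 u))"
      by (intro integrable_mult_right integrable_norm integrable_smooth_kernel) auto
    show "fejer_kernel \<in> borel_measurable lborel"
      using borel_measurable_continuous_onI[OF continuous_on_fejer_kernel] by simp
    show "AE u in lborel. norm (fejer_kernel u) \<le> norm (M * norm (smooth_kernel (-1) 1 u))"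
      using M(1) le' by (intro always_eventually allI)
        (auto simp: fejer_kernel_def power2_eq_square abs_mult intro!: mult_right_mono)
  qed
qed

text \<open>At 0 the exponential is 1, and the unsquared kernel is the integral of (1 - t^2)^3 over
  [-1, 1], which is 32/35.\<close>

lemma fejer_kernel_0_pos: "fejer_kernel 0 > 0"
proof -
  have "((\<lambda>t::real. (1\<^sup>2 - t\<^sup>2) ^ 3) has_integral
          ((1 - 1 ^ 3 + 3 / 5 * 1 ^ 5 - 1 / 7 * 1 ^ 7) - (-1 - (-1) ^ 3 + 3 / 5 * (-1) ^ 5 - 1 / 7 * (-1) ^ 7))) {-1..1}"
    by (rule fundamental_theorem_of_calculus[where f = "\<lambda>t. t - t ^ 3 + 3 / 5 * t ^ 5 - 1 / 7 * t ^ 7"])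
       (auto intro!: derivative_eq_intros simp flip: has_real_derivative_iff_has_vector_derivative
             simp: field_simps power2_eq_square power_numeral_reduce)
  hence "((\<lambda>t. of_real ((1\<^sup>2 - t\<^sup>2) ^ 3) :: complex) has_integral of_real (32 / 35)) {-1..1}"
    by (intro has_integral_of_real) simp
  hence "smooth_kernel (-1) 1 0 = of_real (32 / 35)"
    unfolding smooth_kernel_def fourier_segment_def endpoint_poly_symmetric
    by (intro integral_unique) simp
  thus ?thesis by (simp only: fejer_kernel_def norm_of_real) simp
qed

lemma integral_fejer_kernel_pos: "integral\<^sup>L lborel fejer_kernel > 0"
proof -
  define c where "c = fejer_kernel 0 / 2"
  have c: "c > 0" "fejer_kernel 0 = 2 * c" using fejer_kernel_0_pos by (auto simp: c_def)
  have "isCont fejer_kernel 0"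
    using continuous_on_fejer_kernel by (simp add: continuous_on_eq_continuous_at)
  then obtain r where r: "r > 0" "\<And>u. \<bar>u\<bar> < r \<Longrightarrow> \<bar>fejer_kernel u - fejer_kernel 0\<bar> < c"
    using c(1) unfolding continuous_at_eps_delta by (auto simp: dist_real_def)
  have "0 < c * (2 * (r / 2))" using c r by simp
  also have "\<dots> = (\<integral>u. c * indicator {- (r / 2)..r / 2} u \<partial>lborel)" using r by simp
  also have "\<dots> \<le> integral\<^sup>L lborel fejer_kernel"
  proof (rule integral_mono)
    fix u :: real
    show "c * indicator {- (r / 2)..r / 2} u \<le> fejer_kernel u"
    proof (cases "u \<in> {- (r / 2)..r / 2}")
      case True
      hence "\<bar>u\<bar> < r" using r by auto
      thus ?thesis using r(2)[of u] c True by auto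
    qed (auto simp: fejer_kernel_def)
  qed (auto intro!: integrable_fejer_kernel integrable_mult_right integrable_real_indicator simp: emeasure_lborel_Icc_eq)
  finally show ?thesis .
qed

text \<open>Where \<open>h\<close> is at least \<epsilon>, it stays above \<epsilon>/2 on an
  interval of length \<delta> to the right; where it is at most -\<epsilon>, it was below
  -\<epsilon>/2 on such an interval to the left. A kernel concentrated at the centre of this
  interval then gives an average of absolute value at least \<open>c\<close>, with \<open>c\<close>
  independent of the position.\<close>

lemma slowly_decreasing_tendsto_0:
  fixes h :: "real \<Rightarrow> real"
  assumes [measurable]: "h \<in> borel_measurable borel"
    and h: "\<And>v. \<bar>h v\<bar> \<le> M"
    and slow: "\<And>v \<delta>. v \<ge> 0 \<Longrightarrow> \<delta> \<ge> 0 \<Longrightarrow> h (v + \<delta>) \<ge> h v - C * \<delta>" and C: "C > 0"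
    and lim: "\<And>L. L > 0 \<Longrightarrow> ((\<lambda>y. \<integral>w. h (y - w) * fejer_kernel (L * w) \<partial>lborel) \<longlongrightarrow> 0) at_top"
  shows "(h \<longlongrightarrow> 0) at_top"
proof (rule tendstoI)
  fix \<epsilon> :: real assume \<epsilon>: "\<epsilon> > 0"
  define \<delta> where "\<delta> = \<epsilon> / (2 * C)"
  have \<delta>: "\<delta> > 0" "C * \<delta> = \<epsilon> / 2" using \<epsilon> C by (auto simp: \<delta>_def)
  have M: "M \<ge> 0" using h[of 0] by linarith
  have [measurable]: "fejer_kernel \<in> borel_measurable borel"
    by (rule borel_measurable_continuous_onI[OF continuous_on_fejer_kernel])
  have K0: "fejer_kernel w \<ge> 0" for w by (simp add: fejer_kernel_def)
  \<comment> \<open>The worst admissible profile: \<epsilon>/2 on a window and only the trivial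
    bound -M outside. As the window grows, its integral tends to \<epsilon>/2 times the mass of the
    kernel, so some \<open>T\<close> makes it positive.\<close>
  define g where "g = (\<lambda>T w :: real. if \<bar>w\<bar> \<le> T then \<epsilon> / 2 else - M)"
  have [measurable]: "g T \<in> borel_measurable borel" for T unfolding g_def by measurable
  have g_le: "\<bar>g T w\<bar> \<le> \<epsilon> / 2 + M" for T w using \<epsilon> M by (auto simp: g_def)
  have K_int: "integrable lborel (\<lambda>w. x w * fejer_kernel (L * w))"
    if "x \<in> borel_measurable borel" "\<And>w. \<bar>x w\<bar> \<le> B" "L > 0" for x :: "real \<Rightarrow> real" and B L
  proof (rule Bochner_Integration.integrable_bound)
    show "integrable lborel (\<lambda>w. B * fejer_kernel (L * w))"
      using lborel_integrable_real_affine[OF integrable_fejer_kernel, of L 0] that(3)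
      by (intro integrable_mult_right) simp
    have "B \<ge> 0" using that(2)[of 0] by linarith
    thus "AE w in lborel. norm (x w * fejer_kernel (L * w)) \<le> norm (B * fejer_kernel (L * w))"
      using that(2) K0 by (intro always_eventually allI) (auto simp: abs_mult intro!: mult_right_mono)
    show "(\<lambda>w. x w * fejer_kernel (L * w)) \<in> borel_measurable lborel" using that(1) by measurable
  qed
  have "((\<lambda>T. \<integral>w. g T w * fejer_kernel w \<partial>lborel) \<longlongrightarrow> (\<integral>w. \<epsilon> / 2 * fejer_kernel w \<partial>lborel)) at_top"
  proof (rule integral_dominated_convergence_at_top[where w = "\<lambda>w. (\<epsilon> / 2 + M) * fejer_kernel w"])
    show "integrable lborel (\<lambda>w. (\<epsilon> / 2 + M) * fejer_kernel w)"
      by (intro integrable_mult_right integrable_fejer_kernel)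
    show "\<forall>\<^sub>F T in at_top. AE w in lborel. norm (g T w * fejer_kernel w) \<le> (\<epsilon> / 2 + M) * fejer_kernel w"
      using g_le K0 by (intro always_eventually allI) (auto simp: abs_mult intro!: mult_right_mono)
    have "((\<lambda>T. g T w * fejer_kernel w) \<longlongrightarrow> \<epsilon> / 2 * fejer_kernel w) at_top" for w
      by (rule tendsto_eventually[OF eventually_mono[OF eventually_ge_at_top[of "\<bar>w\<bar>"]]]) (auto simp: g_def)
    thus "AE w in lborel. ((\<lambda>T. g T w * fejer_kernel w) \<longlongrightarrow> \<epsilon> / 2 * fejer_kernel w) at_top" by simp
  qed measurable
  moreover have "(\<integral>w. \<epsilon> / 2 * fejer_kernel w \<partial>lborel) > 0"
    using integral_fejer_kernel_pos \<epsilon> by simp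
  ultimately have "\<forall>\<^sub>F T in at_top. (\<integral>w. g T w * fejer_kernel w \<partial>lborel) > 0"
    by (rule order_tendstoD)
  hence "\<forall>\<^sub>F T in at_top. T > 0 \<and> (\<integral>w. g T w * fejer_kernel w \<partial>lborel) > 0"
    by (intro eventually_conj eventually_gt_at_top)
  then obtain T where T: "T > 0" "(\<integral>w. g T w * fejer_kernel w \<partial>lborel) > 0"
    using eventually_happens' trivial_limit_at_top_linorder by blast
  \<comment> \<open>This scale shrinks the window |w| <= T to |w| <= \<delta>/2, half the length
    available on either side of the centre.\<close>
  define L where "L = 2 * T / \<delta>"
  have L: "L > 0" using T \<delta> by (simp add: L_def)
  define c where "c = (\<integral>w. g T (L * w) * fejer_kernel (L * w) \<partial>lborel)"
  have c: "c > 0"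
    using lborel_integral_real_affine[of L "\<lambda>w. g T w * fejer_kernel w" 0] L T
    by (simp add: c_def zero_less_mult_iff)
  have g_L: "g T (L * w) = (if \<bar>w\<bar> \<le> \<delta> / 2 then \<epsilon> / 2 else - M)" for w
  proof -
    have "\<bar>L * w\<bar> \<le> T \<longleftrightarrow> \<bar>w\<bar> \<le> \<delta> / 2"
      using L T \<delta> by (auto simp: L_def abs_mult field_simps)
    thus ?thesis by (simp add: g_def)
  qed
  have lower: "c \<le> (\<integral>w. x (y - w) * fejer_kernel (L * w) \<partial>lborel)"
    if [measurable]: "x \<in> borel_measurable borel" and x: "\<And>v. \<bar>x v\<bar> \<le> M"
      and near: "\<And>w. \<bar>w\<bar> \<le> \<delta> / 2 \<Longrightarrow> x (y - w) \<ge> \<epsilon> / 2" for x y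
    unfolding c_def
  proof (rule integral_mono)
    show "integrable lborel (\<lambda>w. g T (L * w) * fejer_kernel (L * w))"
      by (rule K_int[OF _ g_le L]) measurable
    show "integrable lborel (\<lambda>w. x (y - w) * fejer_kernel (L * w))"
      by (rule K_int[OF _ x L]) measurable
    show "g T (L * w) * fejer_kernel (L * w) \<le> x (y - w) * fejer_kernel (L * w)" for w
      using near[of w] x[of "y - w"] unfolding g_L by (intro mult_right_mono K0) (auto simp: abs_le_iff)
  qed
  obtain Y where Y: "\<And>y. y \<ge> Y \<Longrightarrow> \<bar>\<integral>w. h (y - w) * fejer_kernel (L * w) \<partial>lborel\<bar> < c"
    using tendstoD[OF lim[OF L] c] by (auto simp: eventually_at_top_linorder dist_real_def)
  \<comment> \<open>The extra \<delta> keeps the window to the left of \<open>v\<close> in the range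
    where \<open>slow\<close> applies, and its centre beyond \<open>Y\<close>.\<close>
  have "\<bar>h v\<bar> < \<epsilon>" if v: "v \<ge> max Y 0 + \<delta>" for v
  proof (rule ccontr)
    assume "\<not> \<bar>h v\<bar> < \<epsilon>"
    then consider "h v \<ge> \<epsilon>" | "h v \<le> -\<epsilon>" by linarith
    thus False
    proof cases
      case 1
      have "h (v + \<delta> / 2 - w) \<ge> \<epsilon> / 2" if "\<bar>w\<bar> \<le> \<delta> / 2" for w
      proof -
        have "h (v + (\<delta> / 2 - w)) \<ge> h v - C * (\<delta> / 2 - w)"
          using that v \<delta> by (intro slow) auto
        moreover have "C * (\<delta> / 2 - w) \<le> C * \<delta>" using that C by (intro mult_left_mono) auto
        ultimately show ?thesis using 1 \<delta> by (simp add: add_diff_eq)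
      qed
      hence "c \<le> (\<integral>w. h (v + \<delta> / 2 - w) * fejer_kernel (L * w) \<partial>lborel)"
        by (intro lower h) auto
      moreover have "v + \<delta> / 2 \<ge> Y" using v \<delta>(1) by linarith
      ultimately show False using Y[of "v + \<delta> / 2"] by linarith
    next
      case 2
      have "- h (v - \<delta> / 2 - w) \<ge> \<epsilon> / 2" if "\<bar>w\<bar> \<le> \<delta> / 2" for w
      proof -
        have "h (v - \<delta> / 2 - w + (\<delta> / 2 + w)) \<ge> h (v - \<delta> / 2 - w) - C * (\<delta> / 2 + w)"
          using that v \<delta> by (intro slow) auto
        moreover have "C * (\<delta> / 2 + w) \<le> C * \<delta>" using that C by (intro mult_left_mono) auto
        ultimately show ?thesis using 2 \<delta> by simp
      qed
      hence "c \<le> (\<integral>w. - h (v - \<delta> / 2 - w) * fejer_kernel (L * w) \<partial>lborel)"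
        using h by (intro lower[of "\<lambda>v. - h v"]) auto
      hence "c \<le> - (\<integral>w. h (v - \<delta> / 2 - w) * fejer_kernel (L * w) \<partial>lborel)" by simp
      moreover have "v - \<delta> / 2 \<ge> Y" using v \<delta>(1) by linarith
      ultimately show False using Y[of "v - \<delta> / 2"] by linarith
    qed
  qed
  thus "\<forall>\<^sub>F v in at_top. dist (h v) 0 < \<epsilon>"
    by (intro eventually_mono[OF eventually_ge_at_top[of "max Y 0 + \<delta>"]]) simp
qed

theorem ingham_tauberian_shifts:
  fixes h :: "real \<Rightarrow> real"
  assumes meas: "h \<in> borel_measurable borel"
    and h: "\<And>v. \<bar>h v\<bar> \<le> M" and h0: "\<And>v. v < 0 \<Longrightarrow> h v = 0"
    and slow: "\<And>v \<delta>. v \<ge> 0 \<Longrightarrow> \<delta> \<ge> 0 \<Longrightarrow> h (v + \<delta>) \<ge> h v - C * \<delta>" and C: "C > 0"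
    and lim: "((\<lambda>v. \<Sum>n. h (v - ln (real (Suc n))) / real (Suc n)) \<longlongrightarrow> 0) at_top"
  shows "(h \<longlongrightarrow> 0) at_top"
proof (rule slowly_decreasing_tendsto_0[OF meas h slow C])
  fix L :: real assume L: "L > 0"
  have "((\<lambda>y. \<integral>w. h (y - w) * (norm (smooth_kernel (-L) L w))\<^sup>2 \<partial>lborel) \<longlongrightarrow> 0) at_top"
    by (rule fejer_convolution_tendsto_0[OF meas h h0 lim]) (use L in auto)
  also have "(\<lambda>y. \<integral>w. h (y - w) * (norm (smooth_kernel (-L) L w))\<^sup>2 \<partial>lborel) =
      (\<lambda>y. (L ^ 7)\<^sup>2 * (\<integral>w. h (y - w) * fejer_kernel (L * w) \<partial>lborel))"
  proof
    fix y
    have "h (y - w) * (norm (smooth_kernel (-L) L w))\<^sup>2 = (L ^ 7)\<^sup>2 * (h (y - w) * fejer_kernel (L * w))" for w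
      unfolding smooth_kernel_scale[OF L] fejer_kernel_def norm_mult power_mult_distrib
      using L by (simp only: norm_of_real power2_abs mult_ac)
    thus "(\<integral>w. h (y - w) * (norm (smooth_kernel (-L) L w))\<^sup>2 \<partial>lborel) =
        (L ^ 7)\<^sup>2 * (\<integral>w. h (y - w) * fejer_kernel (L * w) \<partial>lborel)"
      by (simp only: integral_mult_right_zero)
  qed
  finally have "((\<lambda>y. (L ^ 7)\<^sup>2 * (\<integral>w. h (y - w) * fejer_kernel (L * w) \<partial>lborel)) \<longlongrightarrow> (L ^ 7)\<^sup>2 * 0) at_top"
    by (simp only: mult_zero_right)
  from tendsto_mult_left[OF this, of "inverse ((L ^ 7)\<^sup>2)"] L
  show "((\<lambda>y. \<integral>w. h (y - w) * fejer_kernel (L * w) \<partial>lborel) \<longlongrightarrow> 0) at_top"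
    by (simp flip: mult.assoc)
qed

section \<open>Chebyshev's bound and the passage from f to h\<close>

lemma real_le_iff_le_nat_floor: "0 \<le> x \<Longrightarrow> real n \<le> x \<longleftrightarrow> n \<le> nat \<lfloor>x\<rfloor>"
  by (simp add: le_nat_iff le_floor_iff)

lemma sum_pairs: "(\<Sum>n=1..2*m. g n) = (\<Sum>j=1..m. g (2 * j - 1) + g (2 * j :: nat) :: real)"
  by (induction m) auto

text \<open>Since F(x/2) collects the terms with even n, the right side is the alternating sum of
  f(x/n). By monotonicity every pair of an odd n and its successor contributes at least 0, and only
  the first pair is kept.\<close>

lemma floor_sum_difference_ge:
  fixes f F :: "real \<Rightarrow> real"
  assumes nonneg: "\<And>x. 1 \<le> x \<Longrightarrow> 0 \<le> f x" and mono: "mono_on {1..} f"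
    and F: "\<And>x. 1 \<le> x \<Longrightarrow> F x = (\<Sum>n | 1 \<le> n \<and> real n \<le> x. f (x / real n))"
    and x: "x \<ge> 2"
  shows "f x - f (x / 2) \<le> F x - 2 * F (x / 2)"
proof -
  \<comment> \<open>The pairs are 2j - 1 and 2j for j <= m; a possible last odd term of
    \<open>F x\<close> stays unpaired and is dropped as nonnegative.\<close>
  define m where "m = nat \<lfloor>x / 2\<rfloor>"
  have m: "real n \<le> x / 2 \<longleftrightarrow> n \<le> m" for n
    unfolding m_def using x by (intro real_le_iff_le_nat_floor) auto
  have m1: "m \<ge> 1" using m[of 1] x by simp
  have set_eq: "{n. 1 \<le> n \<and> real n \<le> x / 2} = {1..m}" unfolding m by auto
  have "F (x / 2) = (\<Sum>j=1..m. f (x / 2 / real j))"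
    using F[of "x / 2"] x unfolding set_eq by simp
  hence F2: "F (x / 2) = (\<Sum>j=1..m. f (x / real (2 * j)))" by (simp add: divide_divide_eq_left)
  have fin: "finite {n. 1 \<le> n \<and> real n \<le> x}"
    by (rule finite_subset[of _ "{..nat \<lfloor>x\<rfloor>}"]) (use x real_le_iff_le_nat_floor[of x] in auto)
  have sub: "{1..2 * m} \<subseteq> {n. 1 \<le> n \<and> real n \<le> x}"
    using m[of m] by auto
  have "f x - f (x / 2) = (\<Sum>j\<in>{1}. f (x / real (2 * j - 1)) - f (x / real (2 * j)))" by simp
  also have "\<dots> \<le> (\<Sum>j=1..m. f (x / real (2 * j - 1)) - f (x / real (2 * j)))"
  proof (rule sum_mono2)
    fix j assume "j \<in> {1..m} - {1}"
    hence j: "1 \<le> j" "real (2 * j) \<le> x" using m[of j] by auto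
    have "x / real (2 * j) \<le> x / real (2 * j - 1)" using j x by (intro divide_left_mono) auto
    moreover have "1 \<le> x / real (2 * j)" using j by (simp add: le_divide_eq)
    ultimately show "0 \<le> f (x / real (2 * j - 1)) - f (x / real (2 * j))"
      using mono_onD[OF mono, of "x / real (2 * j)" "x / real (2 * j - 1)"] by auto
  qed (use m1 in auto)
  also have "\<dots> = (\<Sum>n=1..2*m. f (x / real n)) - 2 * F (x / 2)"
    unfolding sum_pairs F2 by (simp add: sum_subtractf sum.distrib)
  also have "(\<Sum>n=1..2*m. f (x / real n)) \<le> F x"
    unfolding F[OF order_trans[OF one_le_numeral x]]
    by (rule sum_mono2[OF fin sub]) (auto intro!: nonneg simp: le_divide_eq)
  finally show ?thesis by simp
qed

text \<open>Repeated halving sums x + x/2 + x/4 + ..., whence the factor 2; once the argument is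
  below \<open>x0\<close>, monotonicity takes over.\<close>

lemma linear_bound_of_halving:
  fixes f :: "real \<Rightarrow> real"
  assumes mono: "mono_on {1..} f" and x0: "x0 \<ge> 2" and C: "C \<ge> 0"
    and half: "\<And>x. x \<ge> x0 \<Longrightarrow> f x - f (x / 2) \<le> C * x"
    and x: "x \<ge> 1"
  shows "f x \<le> f x0 + 2 * C * x"
proof -
  have *: "f x \<le> f x0 + 2 * C * x" if "1 \<le> x" "x \<le> 2 ^ k * x0" for k x
    using that
  proof (induction k arbitrary: x)
    case 0
    hence "f x \<le> f x0" using x0 by (intro mono_onD[OF mono]) auto
    moreover have "0 \<le> 2 * C * x" using C 0 by simp
    ultimately show ?case by linarith
  next
    case (Suc k)
    show ?case
    proof (cases "x \<le> x0")
      case True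
      hence "f x \<le> f x0" using x0 Suc by (intro mono_onD[OF mono]) auto
      moreover have "0 \<le> 2 * C * x" using C Suc by simp
      ultimately show ?thesis by linarith
    next
      case False
      have "f (x / 2) \<le> f x0 + 2 * C * (x / 2)" using Suc.prems False x0 by (intro Suc.IH) auto
      thus ?thesis using half[of x] False by simp
    qed
  qed
  obtain k where "x / x0 < 2 ^ k" using real_arch_pow[of 2 "x / x0"] by auto
  hence "x \<le> 2 ^ k * x0" using x0 by (simp add: field_simps)
  thus ?thesis using * x by blast
qed

lemma harm_floor_minus_ln_tendsto: "((\<lambda>x::real. harm (nat \<lfloor>x\<rfloor>) - ln x) \<longlongrightarrow> euler_mascheroni) at_top"
proof -
  have "filterlim (\<lambda>x::real. nat \<lfloor>x\<rfloor>) sequentially at_top"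
    by (intro filterlim_compose[OF filterlim_nat_sequentially filterlim_floor_sequentially])
  from filterlim_compose[OF euler_mascheroni_LIMSEQ this]
  have "((\<lambda>x::real. harm (nat \<lfloor>x\<rfloor>) - ln (real (nat \<lfloor>x\<rfloor>))) \<longlongrightarrow> euler_mascheroni) at_top" .
  moreover have "((\<lambda>x::real. ln (real (nat \<lfloor>x\<rfloor>)) - ln x) \<longlongrightarrow> 0) at_top"
    by real_asymp
  ultimately have "((\<lambda>x::real. (harm (nat \<lfloor>x\<rfloor>) - ln (real (nat \<lfloor>x\<rfloor>))) + (ln (real (nat \<lfloor>x\<rfloor>)) - ln x)) \<longlongrightarrow> euler_mascheroni + 0) at_top"
    by (rule tendsto_add)
  thus ?thesis by simp
qed

lemma floor_sum_over_x_tendsto: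
  fixes F :: "real \<Rightarrow> real"
  assumes "(\<lambda>x. F x - (A * x * ln x + B * x + C * (x / ln x))) \<in> o[at_top](\<lambda>x. x / ln x)"
  shows "((\<lambda>x. F x / x - A * ln x) \<longlongrightarrow> B) at_top"
proof -
  let ?r = "\<lambda>x. F x - (A * x * ln x + B * x + C * (x / ln x))"
  have "((\<lambda>x. ?r x / (x / ln x)) \<longlongrightarrow> 0) at_top"
    by (rule smalloD_tendsto[OF assms])
  moreover have "((\<lambda>x::real. 1 / ln x) \<longlongrightarrow> 0) at_top" "((\<lambda>x::real. B + C / ln x) \<longlongrightarrow> B) at_top"
    by real_asymp+
  ultimately have "((\<lambda>x. ?r x / (x / ln x) * (1 / ln x) + (B + C / ln x)) \<longlongrightarrow> 0 * 0 + B) at_top"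
    by (intro tendsto_add tendsto_mult)
  moreover have "\<forall>\<^sub>F x in at_top. ?r x / (x / ln x) * (1 / ln x) + (B + C / ln x) = F x / x - A * ln x"
    using eventually_gt_at_top[of 1]
  proof eventually_elim
    case (elim x)
    hence "ln x > 0" by simp
    thus ?case using elim by (simp add: field_simps)
  qed
  ultimately show ?thesis by (simp add: filterlim_cong)
qed

theorem theorem1p1:
  fixes f F :: "real \<Rightarrow> real" and A B C :: real
  assumes nonneg: "\<And>x. 1 \<le> x \<Longrightarrow> 0 \<le> f x"
    and mono: "mono_on {1..} f"
    and F: "\<And>x. 1 \<le> x \<Longrightarrow> F x = (\<Sum>n | 1 \<le> n \<and> real n \<le> x. f (x / real n))"
    and asymp: "(\<lambda>x. F x - (A * x * ln x + B * x + C * (x / ln x))) \<in> o[at_top](\<lambda>x. x / ln x)"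
  shows "(\<lambda>x. f x - A * x) \<in> o[at_top](\<lambda>x. x)"
proof -
  have F_lim: "((\<lambda>x. F x / x - A * ln x) \<longlongrightarrow> B) at_top"
    by (rule floor_sum_over_x_tendsto[OF asymp])

  obtain M1 where M1: "M1 \<ge> 0" "\<And>x. x \<ge> 1 \<Longrightarrow> f x \<le> M1 * x"
  proof -
    have half: "filterlim (\<lambda>x::real. x / 2) at_top at_top" by real_asymp
    \<comment> \<open>The logarithms cancel up to A log 2, so F x - 2 F (x / 2) is O(x) although
      \<open>F x\<close> may be of order x log x.\<close>
    have "((\<lambda>x. (F x / x - A * ln x) - (F (x / 2) / (x / 2) - A * ln (x / 2)) + A * ln 2) \<longlongrightarrow> B - B + A * ln 2) at_top"
      by (intro tendsto_intros F_lim filterlim_compose[OF F_lim half])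
    moreover have "\<forall>\<^sub>F x in at_top. (F x / x - A * ln x) - (F (x / 2) / (x / 2) - A * ln (x / 2)) + A * ln 2 =
        (F x - 2 * F (x / 2)) / x"
      using eventually_gt_at_top[of 0] by eventually_elim (simp add: ln_div field_simps)
    ultimately have "((\<lambda>x. (F x - 2 * F (x / 2)) / x) \<longlongrightarrow> A * ln 2) at_top"
      by (simp add: filterlim_cong)
    hence "\<forall>\<^sub>F x in at_top. (F x - 2 * F (x / 2)) / x < \<bar>A * ln 2\<bar> + 1"
      by (rule order_tendstoD) linarith
    then obtain x1 where x1: "\<And>x. x \<ge> x1 \<Longrightarrow> (F x - 2 * F (x / 2)) / x < \<bar>A * ln 2\<bar> + 1"
      by (auto simp: eventually_at_top_linorder)
    define x0 where "x0 = max x1 2"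
    define c where "c = \<bar>A * ln 2\<bar> + 1"
    have c: "c \<ge> 0" by (simp add: c_def)
    have "f x - f (x / 2) \<le> c * x" if "x \<ge> x0" for x
    proof -
      have x: "x \<ge> 2" "x \<ge> x1" using that by (auto simp: x0_def)
      have "F x - 2 * F (x / 2) \<le> c * x" using x1[OF x(2)] x(1) by (simp add: c_def pos_divide_less_eq)
      thus ?thesis using floor_sum_difference_ge[OF nonneg mono F x(1)] by linarith
    qed
    hence bound: "f x \<le> f x0 + 2 * c * x" if "x \<ge> 1" for x
      using linear_bound_of_halving[OF mono _ c _ that, of x0] by (simp add: x0_def)
    have f0: "f x0 \<ge> 0" by (rule nonneg) (simp add: x0_def)
    have "f x \<le> (f x0 + 2 * c) * x" if "x \<ge> 1" for x
      using bound[OF that] mult_left_mono[OF that f0] by (simp add: ring_distribs)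
    thus ?thesis using that[of "f x0 + 2 * c"] f0 c by simp
  qed

  \<comment> \<open>Subtracting \<open>A x + b\<close> from \<open>f\<close> subtracts \<open>A x log x + (A \<gamma> + b) x + O(1)\<close> from \<open>F\<close>; this \<open>b\<close> leaves \<open>o(x)\<close>.\<close>
  define b where "b = B - A * euler_mascheroni"
  \<comment> \<open>Cutting off at 0 makes the series over all n equal to the sum over n <=
    e^v.\<close>
  define h where "h = (\<lambda>v. if v \<ge> 0 then exp (-v) * (f (exp v) - A * exp v - b) else 0)"
  have h_pos: "h v = exp (-v) * f (exp v) - A - b * exp (-v)" if "v \<ge> 0" for v
    using that by (simp add: h_def algebra_simps flip: exp_add)

  have h_meas: "h \<in> borel_measurable borel"
  proof -
    \<comment> \<open>Extended by 0 to the left of 1, \<open>f\<close> is still monotone because it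
      is nonnegative, and monotone functions are Borel.\<close>
    define f0 where "f0 = (\<lambda>x. if x \<ge> 1 then f x else 0)"
    have "mono f0"
      using nonneg mono by (auto simp: f0_def mono_def mono_on_def)
    hence [measurable]: "f0 \<in> borel_measurable borel" by (rule borel_measurable_mono)
    have "h = (\<lambda>v. if v \<ge> 0 then exp (-v) * (f0 (exp v) - A * exp v - b) else 0)"
      by (auto simp: h_def f0_def)
    thus ?thesis by simp
  qed

  define M where "M = M1 + \<bar>A\<bar> + \<bar>b\<bar>"
  have h_bound: "\<bar>h v\<bar> \<le> M" for v
  proof (cases "v \<ge> 0")
    case True
    have "exp (-v) * f (exp v) \<le> exp (-v) * (M1 * exp v)" using M1(2)[of "exp v"] True by simp
    hence "exp (-v) * f (exp v) \<le> M1" by (simp add: mult.left_commute flip: exp_add)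
    moreover have "exp (-v) * f (exp v) \<ge> 0" using nonneg[of "exp v"] True by simp
    moreover have "\<bar>b * exp (-v)\<bar> \<le> \<bar>b\<bar> * 1" unfolding abs_mult using True by (intro mult_left_mono) auto
    ultimately show ?thesis unfolding h_pos[OF True] M_def by linarith
  next
    case False
    thus ?thesis using M1(1) by (simp add: h_def M_def)
  qed

  \<comment> \<open>Since f(e^v) may be kept as a lower bound, the only loss is the factor
    e^(-\<delta>) on h v + A, the part of \<open>h\<close> without the constant -A, and 1 -
    e^(-\<delta>) <= \<delta>. The summand 1 makes the constant strictly positive.\<close>
  have slow: "h (v + \<delta>) \<ge> h v - (M + \<bar>A\<bar> + 1) * \<delta>" if "v \<ge> 0" "\<delta> \<ge> 0" for v \<delta>
  proof -
    have "f (exp v) \<le> f (exp (v + \<delta>))" using that by (intro mono_onD[OF mono]) auto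
    hence "exp (- (v + \<delta>)) * f (exp v) \<le> exp (- (v + \<delta>)) * f (exp (v + \<delta>))" by simp
    hence "exp (- (v + \<delta>)) * f (exp v) - A - b * exp (- (v + \<delta>)) \<le> h (v + \<delta>)"
      unfolding h_pos[OF add_nonneg_nonneg[OF that]] by simp
    moreover have "exp (- (v + \<delta>)) * f (exp v) - A - b * exp (- (v + \<delta>)) = h v - (1 - exp (-\<delta>)) * (h v + A)"
    proof -
      have "exp (- (v + \<delta>)) = exp (-v) * exp (-\<delta>)" by (simp flip: exp_add)
      thus ?thesis unfolding h_pos[OF that(1)] by (simp only:) (simp add: algebra_simps)
    qed
    moreover have "(1 - exp (-\<delta>)) * (h v + A) \<le> \<delta> * (M + \<bar>A\<bar> + 1)"
    proof (rule order_trans)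
      show "(1 - exp (-\<delta>)) * (h v + A) \<le> (1 - exp (-\<delta>)) * (M + \<bar>A\<bar> + 1)"
        using h_bound[of v] that by (intro mult_left_mono) auto
      have "1 - exp (-\<delta>) \<le> \<delta>" using exp_ge_add_one_self[of "-\<delta>"] by simp
      thus "(1 - exp (-\<delta>)) * (M + \<bar>A\<bar> + 1) \<le> \<delta> * (M + \<bar>A\<bar> + 1)"
        using M1(1) by (intro mult_right_mono) (auto simp: M_def)
    qed
    ultimately show ?thesis by (simp add: mult.commute)
  qed

  \<comment> \<open>For n >= 1 the summand is e^(-v) (f(e^v / n) - A e^v / n - b): the three parts
    add up to \<open>F\<close>, a harmonic number and a count of terms.\<close>
  have H_eq: "(\<Sum>n. h (v - ln (real (Suc n))) / real (Suc n)) =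
      F (exp v) / exp v - A * harm (nat \<lfloor>exp v\<rfloor>) - b * (real (nat \<lfloor>exp v\<rfloor>) / exp v)" if v: "v \<ge> 0" for v
  proof -
    define m where "m = nat \<lfloor>exp v\<rfloor>"
    have m: "real n \<le> exp v \<longleftrightarrow> n \<le> m" for n
      unfolding m_def by (intro real_le_iff_le_nat_floor) auto
    have ln_le: "ln (real (Suc n)) \<le> v \<longleftrightarrow> Suc n \<le> m" for n
      unfolding m[symmetric] by (metis exp_gt_zero ln_exp ln_le_cancel_iff of_nat_0_less_iff zero_less_Suc)
    have "(\<Sum>n. h (v - ln (real (Suc n))) / real (Suc n)) = (\<Sum>n<m. h (v - ln (real (Suc n))) / real (Suc n))"
    proof (rule suminf_finite)
      fix n assume "n \<notin> {..<m}"
      hence "\<not> ln (real (Suc n)) \<le> v" using ln_le[of n] by simp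
      thus "h (v - ln (real (Suc n))) / real (Suc n) = 0" by (simp add: h_def)
    qed auto
    also have "\<dots> = (\<Sum>n<m. f (exp v / real (Suc n)) / exp v - A * inverse (real (Suc n)) - b / exp v)"
    proof (rule sum.cong)
      fix n assume "n \<in> {..<m}"
      hence "v - ln (real (Suc n)) \<ge> 0" using ln_le[of n] by simp
      moreover have "exp (- (v - ln (real (Suc n)))) = real (Suc n) / exp v"
        by (simp add: exp_diff del: of_nat_Suc)
      moreover have "exp (v - ln (real (Suc n))) = exp v / real (Suc n)"
        by (simp add: exp_diff del: of_nat_Suc)
      ultimately show "h (v - ln (real (Suc n))) / real (Suc n) =
          f (exp v / real (Suc n)) / exp v - A * inverse (real (Suc n)) - b / exp v"
        by (simp only: h_pos) (simp add: divide_simps del: of_nat_Suc)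
    qed auto
    also have "\<dots> = (\<Sum>n=1..m. f (exp v / real n)) / exp v - A * harm m - b * (real m / exp v)"
      by (simp add: sum_subtractf harm_def sum.atLeast1_atMost_eq sum_distrib_left sum_divide_distrib)
    also have "(\<Sum>n=1..m. f (exp v / real n)) = F (exp v)"
    proof -
      have "{n. 1 \<le> n \<and> real n \<le> exp v} = {1..m}" unfolding m by auto
      thus ?thesis using F[of "exp v"] v by simp
    qed
    finally show ?thesis by (simp only: m_def)
  qed

  have "((\<lambda>v. \<Sum>n. h (v - ln (real (Suc n))) / real (Suc n)) \<longlongrightarrow> 0) at_top"
  proof -
    have "((\<lambda>x::real. real (nat \<lfloor>x\<rfloor>) / x) \<longlongrightarrow> 1) at_top" by real_asymp
    hence "((\<lambda>x. (F x / x - A * ln x) - A * (harm (nat \<lfloor>x\<rfloor>) - ln x) - b * (real (nat \<lfloor>x\<rfloor>) / x)) \<longlongrightarrow>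
        B - A * euler_mascheroni - b * 1) at_top"
      by (intro tendsto_intros F_lim harm_floor_minus_ln_tendsto)
    hence "((\<lambda>x. F x / x - A * harm (nat \<lfloor>x\<rfloor>) - b * (real (nat \<lfloor>x\<rfloor>) / x)) \<longlongrightarrow> 0) at_top"
      by (simp add: b_def algebra_simps)
    from filterlim_compose[OF this exp_at_top]
    show ?thesis
    proof (rule Lim_transform_eventually)
      show "\<forall>\<^sub>F v in at_top. F (exp v) / exp v - A * harm (nat \<lfloor>exp v\<rfloor>) - b * (real (nat \<lfloor>exp v\<rfloor>) / exp v) =
          (\<Sum>n. h (v - ln (real (Suc n))) / real (Suc n))"
        by (intro eventually_mono[OF eventually_ge_at_top[of 0]]) (rule H_eq[symmetric])
    qed
  qed
  hence "(h \<longlongrightarrow> 0) at_top"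
    using M1(1) by (intro ingham_tauberian_shifts[OF h_meas h_bound _ slow]) (auto simp: h_def M_def)
  \<comment> \<open>Back to x = e^v; the term b / x restores the constant that was subtracted along
    with A x.\<close>
  from filterlim_compose[OF this ln_at_top]
  have "((\<lambda>x. h (ln x) + b / x) \<longlongrightarrow> 0 + 0) at_top"
    by (rule tendsto_add) real_asymp
  hence "((\<lambda>x. h (ln x) + b / x) \<longlongrightarrow> 0) at_top" by simp
  moreover have "\<forall>\<^sub>F x in at_top. h (ln x) + b / x = (f x - A * x) / x"
    using eventually_gt_at_top[of 1]
    by eventually_elim (simp add: h_pos exp_minus field_simps)
  ultimately have "((\<lambda>x. (f x - A * x) / x) \<longlongrightarrow> 0) at_top"
    by (rule Lim_transform_eventually)
  thus ?thesis
    by (rule smalloI_tendsto) (use eventually_gt_at_top[of 0] in \<open>auto elim: eventually_mono\<close>)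
qed

end
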